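(* Let $n\ge2$ be an integer. The $(n,n+i)$-cuspidal curvature $\omega_{n,n+i}$ $(i=1,\dots,n-1)$ and the $(n,2n)$-bias $\beta_{n,2n}$ of generic helicoidal $n$-type edges are extrinsic invariants.
   Context: All manifolds and maps are $C^\infty$. Let $\Sigma$ be an oriented smooth $2$-manifold and $f:\Sigma\to\mathbb{R}^3$ a smooth map. A point where $f$ is not an immersion is a singular point; $S(f)$ is the set of singular points. $f$ is a surface if $\Sigma\setminus S(f)$ is dense. The first fundamental form $g_f$ is the pullback by $f$ of the Euclidean metric. A surface $f$ is a frontal if each point has an open neighborhood $D$ with a smooth map $\nu:D\to S^2$ (unit normal vector field) such that $df_q(v)\cdot\nu(q)=0$ for all $q\in D$, $v\in T_q\Sigma$. Two map-germs are $\mathcal{A}$-equivalent if they agree up to diffeomorphism-germs of source and target. A point $p$ is an $n$-type edge singular point of $f$ if there is a smooth function $a(u,v)$ such that the germ of $f$ at $p$ is $\mathcal{A}$-equivalent to the germ at the origin of $(u,v)\mapsto(u^n,u^{n+1}a(u,v),v)$. A singular point $p$ is of rank one if $\operatorname{rank}(df_p)=1$. For a frontal $f$ and a rank one singular point $p$, take an orientation-compatible coordinate system $(u,v)$ with $f_u(p)=0$; the limiting normal curvature is $\kappa_\nu(p)=\dfrac{f_{vv}(p)\cdot\nu(p)}{\|f_v(p)\|^2}$ (independent of the choice of such coordinates). A rank one singular point is generic if $\kappa_\nu(p)\ne0$. A helicoidal motion is a non-trivial one-parameter subgroup of the isometry group of $\mathbb{R}^3$. A generic helicoidal $n$-type edge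 ($n>1$) is a frontal in $\mathbb{R}^3$ that is invariant under a helicoidal motion, has non-empty singular set, and all of whose singular points are generic $n$-type edge singular points. For a frontal $f$ with an $n$-type edge at $p$, let $\xi,\eta$ be vector fields near $p$ such that $\xi$ is non-zero and tangent to $S(f)$ along $S(f)$, $\eta$ is non-vanishing with $df(\eta)=0$ on $S(f)$, $\eta^jf=0$ on $S(f)$ for $j=2,\dots,n-1$, and $\xi f(p)$, $\eta^nf(p)$ are linearly independent ($\zeta^jf$ denotes the $j$-times directional derivative of $f$ by $\zeta$). For $i=1,\dots,n$ set $$\omega_{n,n+i}(p)=\frac{\|\xi f\|^{(n+i)/n}\det(\xi f,\eta^nf,\eta^{n+i}f)}{\|\xi f\times\eta^nf\|^{(2n+i)/n}}(p).$$ $\omega_{n,n+1}$ is always defined; for $i>1$, $\omega_{n,n+i}$ is defined as an invariant when $\omega_{n,n+j}$ $(j=1,\dots,i-1)$ vanish identically on $S(f)$ (then it does not depend on the choice of $\xi,\eta$). For $1\le i\le n-1$, $\omega_{n,n+i}$ is the $(n,n+i)$-cuspidal curvature, and $\beta_{n,2n}:=\omega_{n,2n}$ is the $(n,2n)$-bias. A geometric invariant $J(f,p)$ is a real number determined by $f$ and $p$ such that $|J(f,p)|=|J(T\circ f\circ\varphi^{-1},p)|$ for any isometry $T$ of $\mathbb{R}^3$ and any diffeomorphism $\varphi$ of a sufficiently small open neighborhood of $p$ with $\varphi(p)=p$. A surface $\bar f$ is isometric to $f$ at $p$ if there exist an open neighborhood $D$ of $p$ and a diffeomorphism $\varphi:D\to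 D$ with $\varphi(p)=p$ and $g_f=\varphi^*g_{\bar f}$ on $D$. A geometric invariant is intrinsic (on a given class of surfaces) if $|J(f,p)|=|J(\bar f,p)|$ whenever $\bar f$ is isometric to $f$ at $p$, and extrinsic if it is not intrinsic, i.e. there exist such $f$, $p$ and a surface $\bar f$ isometric to $f$ at $p$ with $|J(f,p)|\ne|J(\bar f,p)|$.
   Formalization: For the bias, the vector fields are additionally required to satisfy ξf(p)·ηⁿf(p)=0; without this the stated formula for ω_{n,2n} depends on the choice of η whenever the limiting normal curvature is non-zero. *)

theory Defs
  imports "HOL-Analysis.Analysis"
begin

section \<open>Smooth maps between Euclidean spaces\<close>

text \<open>All directional derivatives of order at most k exist and are continuous. Only used on
  open sets, where demanding this for all k is the usual notion of a smooth map.\<close>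

primrec times_differentiable_on ::
  "nat \<Rightarrow> 'a::euclidean_space set \<Rightarrow> ('a \<Rightarrow> 'b::euclidean_space) \<Rightarrow> bool" where
  "times_differentiable_on 0 U f \<longleftrightarrow> continuous_on U f"
| "times_differentiable_on (Suc k) U f \<longleftrightarrow>
     (\<forall>x\<in>U. f differentiable (at x)) \<and>
     (\<forall>v. times_differentiable_on k U (\<lambda>x. frechet_derivative f (at x) v))"

definition smooth_on :: "'a::euclidean_space set \<Rightarrow> ('a \<Rightarrow> 'b::euclidean_space) \<Rightarrow> bool" where
  "smooth_on U f \<longleftrightarrow> (\<forall>k. times_differentiable_on k U f)"

definition diffeo_germ :: "('a::euclidean_space \<Rightarrow> 'a) \<Rightarrow> 'a \<Rightarrow> 'a \<Rightarrow> bool" where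
  "diffeo_germ \<psi> x y \<longleftrightarrow>
     (\<exists>U V. open U \<and> open V \<and> x \<in> U \<and> \<psi> x = y \<and> bij_betw \<psi> U V \<and>
        smooth_on U \<psi> \<and> smooth_on V (inv_into U \<psi>))"

text \<open>The derivative of g along the vector field z, as a function; the iterate
  \<open>(dir_deriv z ^^ j) g\<close> is the j-times directional derivative of g by z.\<close>

definition dir_deriv ::
  "('a::euclidean_space \<Rightarrow> 'a) \<Rightarrow> ('a \<Rightarrow> 'b::euclidean_space) \<Rightarrow> 'a \<Rightarrow> 'b" where
  "dir_deriv \<zeta> g = (\<lambda>x. frechet_derivative g (at x) (\<zeta> x))"

abbreviation e_u :: "real^2" where "e_u \<equiv> axis 1 1"
abbreviation e_v :: "real^2" where "e_v \<equiv> axis 2 1"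


section \<open>Oriented smooth 2-manifolds\<close>

text \<open>A chart is its domain together with its coordinate map. The coordinate map is only
  meaningful on the domain, so it is inverted with \<open>inv_into\<close>.\<close>

type_synonym 'a chart = "'a set \<times> ('a \<Rightarrow> real^2)"

record 'a manifold =
  top_of :: "'a topology"
  atlas :: "'a chart set"

abbreviation points :: "'a manifold \<Rightarrow> 'a set" where
  "points M \<equiv> topspace (top_of M)"

definition local_rep :: "'a chart \<Rightarrow> ('a \<Rightarrow> 'b) \<Rightarrow> real^2 \<Rightarrow> 'b" where
  "local_rep c f = f \<circ> inv_into (fst c) (snd c)"

definition coordinate_chart :: "'a topology \<Rightarrow> 'a chart \<Rightarrow> bool" where
  "coordinate_chart X c \<longleftrightarrow>
     openin X (fst c) \<and> open (snd c ` fst c) \<and>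
     homeomorphic_map (subtopology X (fst c)) (top_of_set (snd c ` fst c)) (snd c)"

definition positive_transition :: "'a chart \<Rightarrow> 'a chart \<Rightarrow> bool" where
  "positive_transition c c' \<longleftrightarrow>
     smooth_on (snd c ` (fst c \<inter> fst c')) (local_rep c (snd c')) \<and>
     (\<forall>x \<in> snd c ` (fst c \<inter> fst c'). det (jacobian (local_rep c (snd c')) (at x)) > 0)"

definition oriented_2_manifold :: "'a manifold \<Rightarrow> bool" where
  "oriented_2_manifold M \<longleftrightarrow>
     Hausdorff_space (top_of M) \<and> second_countable (top_of M) \<and>
     (\<Union>c\<in>atlas M. fst c) = points M \<and>
     (\<forall>c\<in>atlas M. coordinate_chart (top_of M) c) \<and>
     (\<forall>c\<in>atlas M. \<forall>c'\<in>atlas M. positive_transition c c')"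

definition charts_at :: "'a manifold \<Rightarrow> 'a \<Rightarrow> 'a chart set" where
  "charts_at M p = {c \<in> atlas M. p \<in> fst c}"

text \<open>All orientation-compatible coordinate systems around p, i.e. charts of the maximal
  oriented atlas.\<close>

definition oriented_coords_at :: "'a manifold \<Rightarrow> 'a \<Rightarrow> 'a chart set" where
  "oriented_coords_at M p =
     {c. coordinate_chart (top_of M) c \<and> p \<in> fst c \<and>
         (\<forall>c'\<in>atlas M. positive_transition c c' \<and> positive_transition c' c)}"

definition smooth_map :: "'a manifold \<Rightarrow> 'a set \<Rightarrow> ('a \<Rightarrow> 'b::euclidean_space) \<Rightarrow> bool" where
  "smooth_map M D f \<longleftrightarrow> (\<forall>c\<in>atlas M. smooth_on (snd c ` (fst c \<inter> D)) (local_rep c f))"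

definition diffeo_of :: "'a manifold \<Rightarrow> 'a set \<Rightarrow> ('a \<Rightarrow> 'a) \<Rightarrow> bool" where
  "diffeo_of M D \<phi> \<longleftrightarrow>
     homeomorphic_map (subtopology (top_of M) D) (subtopology (top_of M) D) \<phi> \<and>
     (\<forall>\<psi>\<in>{\<phi>, inv_into D \<phi>}. \<forall>c\<in>atlas M. \<forall>c'\<in>atlas M.
        smooth_on (snd c ` {q \<in> fst c \<inter> D. \<psi> q \<in> fst c'}) (local_rep c (snd c' \<circ> \<psi>)))"

text \<open>Differential at q of a map into a Euclidean space; a tangent vector at q is given by its
  components in the chart c.\<close>

definition diff_at ::
  "'a chart \<Rightarrow> ('a \<Rightarrow> 'b::euclidean_space) \<Rightarrow> 'a \<Rightarrow> real^2 \<Rightarrow> 'b" where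
  "diff_at c f q = frechet_derivative (local_rep c f) (at (snd c q))"


section \<open>Surfaces, frontals, isometry\<close>

definition singular_set :: "'a manifold \<Rightarrow> ('a \<Rightarrow> real^3) \<Rightarrow> 'a set" where
  "singular_set M f = {p \<in> points M. \<exists>c\<in>charts_at M p. \<not> inj (diff_at c f p)}"

definition surface :: "'a manifold \<Rightarrow> ('a \<Rightarrow> real^3) \<Rightarrow> bool" where
  "surface M f \<longleftrightarrow>
     oriented_2_manifold M \<and> smooth_map M (points M) f \<and>
     top_of M closure_of (points M - singular_set M f) = points M"

definition unit_normal_on ::
  "'a manifold \<Rightarrow> ('a \<Rightarrow> real^3) \<Rightarrow> 'a set \<Rightarrow> ('a \<Rightarrow> real^3) \<Rightarrow> bool" where
  "unit_normal_on M f D \<nu> \<longleftrightarrow>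
     smooth_map M D \<nu> \<and>
     (\<forall>q\<in>D. norm (\<nu> q) = 1 \<and> (\<forall>c\<in>charts_at M q. \<forall>X. diff_at c f q X \<bullet> \<nu> q = 0))"

definition frontal :: "'a manifold \<Rightarrow> ('a \<Rightarrow> real^3) \<Rightarrow> bool" where
  "frontal M f \<longleftrightarrow>
     surface M f \<and>
     (\<forall>p\<in>points M. \<exists>D \<nu>. openin (top_of M) D \<and> p \<in> D \<and> unit_normal_on M f D \<nu>)"

definition first_fundamental_form ::
  "'a chart \<Rightarrow> ('a \<Rightarrow> real^3) \<Rightarrow> 'a \<Rightarrow> real^2 \<Rightarrow> real^2 \<Rightarrow> real" where
  "first_fundamental_form c f q X Y = diff_at c f q X \<bullet> diff_at c f q Y"

definition isometric_at :: "'a manifold \<Rightarrow> ('a \<Rightarrow> real^3) \<Rightarrow> ('a \<Rightarrow> real^3) \<Rightarrow> 'a \<Rightarrow> bool" where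
  "isometric_at M f\<^sub>2 f p \<longleftrightarrow>
     (\<exists>D \<phi>. openin (top_of M) D \<and> p \<in> D \<and> diffeo_of M D \<phi> \<and> \<phi> p = p \<and>
        (\<forall>q\<in>D. \<forall>c\<in>charts_at M q. \<forall>c'\<in>charts_at M (\<phi> q). \<forall>X Y.
           first_fundamental_form c f q X Y =
           first_fundamental_form c' f\<^sub>2 (\<phi> q)
             (diff_at c (snd c' \<circ> \<phi>) q X) (diff_at c (snd c' \<circ> \<phi>) q Y)))"


section \<open>Generic helicoidal n-type edges\<close>

definition n_type_edge_model :: "nat \<Rightarrow> (real^2 \<Rightarrow> real) \<Rightarrow> real^2 \<Rightarrow> real^3" where
  "n_type_edge_model n a = (\<lambda>x. vector [x$1 ^ n, x$1 ^ (n+1) * a x, x$2])"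

definition n_type_edge_at :: "nat \<Rightarrow> 'a manifold \<Rightarrow> ('a \<Rightarrow> real^3) \<Rightarrow> 'a \<Rightarrow> bool" where
  "n_type_edge_at n M f p \<longleftrightarrow>
     (\<exists>c\<in>charts_at M p. \<exists>a \<psi> \<Psi> W.
        open W \<and> 0 \<in> W \<and> smooth_on W a \<and>
        diffeo_germ \<psi> (snd c p) 0 \<and> diffeo_germ \<Psi> (f p) 0 \<and>
        (\<forall>\<^sub>F x in nhds (snd c p). \<Psi> (local_rep c f x) = n_type_edge_model n a (\<psi> x)))"

definition rank_one_at :: "'a manifold \<Rightarrow> ('a \<Rightarrow> real^3) \<Rightarrow> 'a \<Rightarrow> bool" where
  "rank_one_at M f p \<longleftrightarrow> (\<exists>c\<in>charts_at M p. dim (range (diff_at c f p)) = 1)"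

definition limiting_normal_curvature ::
  "'a chart \<Rightarrow> ('a \<Rightarrow> real^3) \<Rightarrow> ('a \<Rightarrow> real^3) \<Rightarrow> 'a \<Rightarrow> real" where
  "limiting_normal_curvature c f \<nu> p =
     (let g = local_rep c f; x = snd c p; dv = dir_deriv (\<lambda>_. e_v)
      in (dv (dv g) x \<bullet> \<nu> p) / (norm (dv g x))\<^sup>2)"

text \<open>The limiting normal curvature depends neither on the oriented coordinates with
  \<open>f\<^sub>u(p) = 0\<close> nor, up to sign, on the unit normal.\<close>

definition generic_at :: "'a manifold \<Rightarrow> ('a \<Rightarrow> real^3) \<Rightarrow> 'a \<Rightarrow> bool" where
  "generic_at M f p \<longleftrightarrow>
     rank_one_at M f p \<and>
     (\<exists>c\<in>oriented_coords_at M p. \<exists>D \<nu>.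
        openin (top_of M) D \<and> p \<in> D \<and> unit_normal_on M f D \<nu> \<and>
        diff_at c f p e_u = 0 \<and> limiting_normal_curvature c f \<nu> p \<noteq> 0)"

text \<open>A distance-preserving self-map of \<open>real^3\<close> is automatically an isometry onto, and a
  continuous one-parameter subgroup of the isometry group is automatically smooth.\<close>

definition helicoidal_motion :: "(real \<Rightarrow> real^3 \<Rightarrow> real^3) \<Rightarrow> bool" where
  "helicoidal_motion T \<longleftrightarrow>
     (\<forall>t x y. dist (T t x) (T t y) = dist x y) \<and>
     T 0 = id \<and> (\<forall>s t. T (s + t) = T s \<circ> T t) \<and>
     (\<forall>x. continuous_on UNIV (\<lambda>t. T t x)) \<and>
     (\<exists>t. T t \<noteq> id)"

text \<open>Invariance is that of the map up to reparametrization; in particular the image is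
  invariant.\<close>

definition invariant_under ::
  "'a manifold \<Rightarrow> ('a \<Rightarrow> real^3) \<Rightarrow> (real \<Rightarrow> real^3 \<Rightarrow> real^3) \<Rightarrow> bool" where
  "invariant_under M f T \<longleftrightarrow>
     (\<forall>t. \<exists>\<phi>. diffeo_of M (points M) \<phi> \<and> (\<forall>q\<in>points M. f (\<phi> q) = T t (f q)))"

definition generic_helicoidal_edge :: "nat \<Rightarrow> 'a manifold \<Rightarrow> ('a \<Rightarrow> real^3) \<Rightarrow> bool" where
  "generic_helicoidal_edge n M f \<longleftrightarrow>
     n > 1 \<and> frontal M f \<and>
     (\<exists>T. helicoidal_motion T \<and> invariant_under M f T) \<and>
     singular_set M f \<noteq> {} \<and>
     (\<forall>p\<in>singular_set M f. n_type_edge_at n M f p \<and> generic_at M f p)"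


section \<open>Cuspidal curvatures and bias\<close>

definition tangent_to :: "(real^2) set \<Rightarrow> real^2 \<Rightarrow> real^2 \<Rightarrow> bool" where
  "tangent_to S x w \<longleftrightarrow>
     (\<exists>\<gamma>. \<gamma> 0 = x \<and> (\<gamma> has_vector_derivative w) (at 0) \<and>
        (\<forall>\<^sub>F t in nhds (0::real). \<gamma> t \<in> S))"

text \<open>Conditions on a pair of vector fields near p, expressed in the chart c.\<close>

definition adapted_pair ::
  "nat \<Rightarrow> 'a manifold \<Rightarrow> ('a \<Rightarrow> real^3) \<Rightarrow> 'a \<Rightarrow> 'a chart \<Rightarrow>
   (real^2 \<Rightarrow> real^2) \<Rightarrow> (real^2 \<Rightarrow> real^2) \<Rightarrow> bool" where
  "adapted_pair n M f p c \<xi> \<eta> \<longleftrightarrow>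
     (let g = local_rep c f; x = snd c p; S = snd c ` (singular_set M f \<inter> fst c)
      in c \<in> charts_at M p \<and>
         (\<exists>N. open N \<and> x \<in> N \<and> N \<subseteq> snd c ` fst c \<and> smooth_on N \<xi> \<and> smooth_on N \<eta> \<and>
            (\<forall>y\<in>N. \<eta> y \<noteq> 0) \<and>
            (\<forall>y\<in>N \<inter> S. \<xi> y \<noteq> 0 \<and> tangent_to S y (\<xi> y)) \<and>
            (\<forall>y\<in>N \<inter> S. dir_deriv \<eta> g y = 0) \<and>
            (\<forall>y\<in>N \<inter> S. \<forall>j\<in>{2..n-1}. (dir_deriv \<eta> ^^ j) g y = 0)) \<and>
         dir_deriv \<xi> g x \<noteq> (dir_deriv \<eta> ^^ n) g x \<and>
         independent {dir_deriv \<xi> g x, (dir_deriv \<eta> ^^ n) g x})"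

definition omega_expr ::
  "nat \<Rightarrow> nat \<Rightarrow> (real^2 \<Rightarrow> real^3) \<Rightarrow> (real^2 \<Rightarrow> real^2) \<Rightarrow> (real^2 \<Rightarrow> real^2) \<Rightarrow> real^2 \<Rightarrow> real" where
  "omega_expr n i g \<xi> \<eta> x =
     (let a = dir_deriv \<xi> g x; b = (dir_deriv \<eta> ^^ n) g x; d = (dir_deriv \<eta> ^^ (n+i)) g x
      in norm a powr (real (n+i) / real n) * det (vector [a, b, d] :: real^3^3)
         / norm (cross3 a b) powr (real (2*n+i) / real n))"

text \<open>On surfaces where the cuspidal curvatures of lower order vanish identically, the value is
  independent, up to sign, of the chart and of the adapted pair.\<close>

definition cuspidal_curvature ::
  "nat \<Rightarrow> nat \<Rightarrow> 'a manifold \<Rightarrow> ('a \<Rightarrow> real^3) \<Rightarrow> 'a \<Rightarrow> real" where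
  "cuspidal_curvature n i M f p =
     (SOME w. \<exists>c \<xi> \<eta>. adapted_pair n M f p c \<xi> \<eta> \<and>
        w = omega_expr n i (local_rep c f) \<xi> \<eta> (snd c p))"

text \<open>For \<open>i = n\<close> that independence requires the normalization
  \<open>\<xi>f(p) \<bullet> \<eta>\<^sup>nf(p) = 0\<close>. Without it, replacing \<open>\<eta> = \<partial>\<^sub>u\<close> by
  \<open>\<partial>\<^sub>u + b u^(n-1) \<partial>\<^sub>v\<close> changes \<open>\<eta>^(2n)f(p)\<close> by, among others, a positive multiple of
  \<open>b\<^sup>2 f\<^sub>v\<^sub>v(p)\<close>, which has a non-zero normal component exactly when the limiting normal curvature
  does not vanish.\<close>

definition bias :: "nat \<Rightarrow> 'a manifold \<Rightarrow> ('a \<Rightarrow> real^3) \<Rightarrow> 'a \<Rightarrow> real" where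
  "bias n M f p =
     (SOME w. \<exists>c \<xi> \<eta>. adapted_pair n M f p c \<xi> \<eta> \<and>
        dir_deriv \<xi> (local_rep c f) (snd c p) \<bullet> (dir_deriv \<eta> ^^ n) (local_rep c f) (snd c p) = 0 \<and>
        w = omega_expr n n (local_rep c f) \<xi> \<eta> (snd c p))"

text \<open>The pointed generic helicoidal n-type edges on which the invariant of order \<open>(n, n+i)\<close> is
  defined; for \<open>i = n\<close> this is the bias.\<close>

definition omega_domain :: "nat \<Rightarrow> nat \<Rightarrow> 'a manifold \<Rightarrow> ('a \<Rightarrow> real^3) \<Rightarrow> 'a \<Rightarrow> bool" where
  "omega_domain n i M f p \<longleftrightarrow>
     generic_helicoidal_edge n M f \<and> p \<in> singular_set M f \<and>
     (\<forall>j\<in>{1..<i}. \<forall>q\<in>singular_set M f. cuspidal_curvature n j M f q = 0)"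


section \<open>Intrinsic and extrinsic invariants\<close>

text \<open>C is a class of pointed surfaces and J assigns a real number to each of them.\<close>

definition intrinsic_on ::
  "('a manifold \<Rightarrow> ('a \<Rightarrow> real^3) \<Rightarrow> 'a \<Rightarrow> bool) \<Rightarrow>
   ('a manifold \<Rightarrow> ('a \<Rightarrow> real^3) \<Rightarrow> 'a \<Rightarrow> real) \<Rightarrow> bool" where
  "intrinsic_on C J \<longleftrightarrow>
     (\<forall>M f f\<^sub>2 p. C M f p \<and> C M f\<^sub>2 p \<and> isometric_at M f\<^sub>2 f p \<longrightarrow> \<bar>J M f p\<bar> = \<bar>J M f\<^sub>2 p\<bar>)"

definition extrinsic_on ::
  "('a manifold \<Rightarrow> ('a \<Rightarrow> real^3) \<Rightarrow> 'a \<Rightarrow> bool) \<Rightarrow>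
   ('a manifold \<Rightarrow> ('a \<Rightarrow> real^3) \<Rightarrow> 'a \<Rightarrow> real) \<Rightarrow> bool" where
  "extrinsic_on C J \<longleftrightarrow> \<not> intrinsic_on C J"

text \<open>Point type for the underlying manifolds: every second countable 2-manifold has at most
  continuum many points, so it is diffeomorphic to one whose points are elements of \<open>real^2\<close>
  (with an arbitrary topology and atlas).\<close>

type_synonym point = "real^2"

end

theory Submission
  imports Defs
begin

text \<open>A rotation is a helicoidal motion, so it is enough to bend surfaces of revolution. The classical
  way to do so is to shrink the radius of rotation by a factor while the angle of rotation is
  stretched by its inverse. For the surface
  \<open>F(u,v) = (m e\<^sup>h cos(v/m), m e\<^sup>h sin(v/m), z(u))\<close> with \<open>h = u^n\<close> and \<open>z' = h' e\<^sup>h \<zeta>\<close> the first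
  fundamental form is \<open>(h' e\<^sup>h)\<^sup>2 (m\<^sup>2 + \<zeta>\<^sup>2) du\<^sup>2 + e\<^bsup>2h\<^esup> dv\<^sup>2\<close>, where \<open>m\<close> and \<open>\<zeta>\<close> enter only through
  \<open>m\<^sup>2 + \<zeta>\<^sup>2\<close> (\<open>first_fundamental_form_F\<close>). The singular points form the line \<open>u = 0\<close>; they are
  \<open>n\<close>-type edges, and they are generic because \<open>\<zeta>(0) > 0\<close> (\<open>generic_helicoidal_edge_F\<close>).

  If \<open>\<zeta> = \<rho> + O(u^i)\<close>, then \<open>z = \<rho> e\<^sup>h + u^(n+i) a(u)\<close> up to a constant: the meridian is straight up to terms of
  order \<open>n + i\<close>, and \<open>a(0)\<close> measures its first deviation from a line. Hence the cuspidal curvatures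
  before the \<open>i\<close>-th one vanish, and the \<open>i\<close>-th one (the bias if \<open>i = n\<close>) is, up to sign, a
  constant depending only on \<open>n\<close>, \<open>i\<close> and \<open>m\<^sup>2 + \<rho>\<^sup>2\<close> times \<open>m a(0)\<close>. As the invariants are defined by
  choosing some adapted pair of vector fields, this has to be shown for every adapted pair
  (\<open>adapted_pair_omega\<close>).

  Now take \<open>m = 1\<close>, \<open>\<zeta> = 1 + u^i\<close>, and on the other hand \<open>m = 1/2\<close>, \<open>\<zeta> = sqrt((1 + u^i)\<^sup>2 + 3/4)\<close>.
  The metrics agree, and so do the values of \<open>m\<^sup>2 + \<rho>\<^sup>2\<close>, but \<open>m a(0)\<close> for the second surface is that of
  the first divided by \<open>2 sqrt(7/4)\<close> (\<open>isometric_edges\<close>). The function \<open>a\<close> that belongs to a given \<open>\<zeta>\<close>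
  solves a differential equation that is singular at \<open>u = 0\<close>; its smooth solution is a moment integral
  (\<open>moment_ode\<close>, \<open>revolution_edge_with_slope\<close>).\<close>

section \<open>Calculus of smooth maps\<close>

lemma times_differentiable_on_cong:
  assumes "open U" "\<And>x. x \<in> U \<Longrightarrow> f x = g x" "times_differentiable_on k U f"
  shows "times_differentiable_on k U g"
  using assms
proof (induction k arbitrary: f g)
  case 0
  then show ?case by (simp cong: continuous_on_cong)
next
  case (Suc k)
  have eq: "frechet_derivative f (at x) = frechet_derivative g (at x)"
    and d: "g differentiable (at x)" if "x \<in> U" for x
  proof -
    have f: "(f has_derivative frechet_derivative f (at x)) (at x)"
      using Suc.prems(3) that by (simp add: frechet_derivative_works)
    have g: "(g has_derivative frechet_derivative f (at x)) (at x)"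
      using has_derivative_transform_within_open[OF f Suc.prems(1) that] Suc.prems(2) by blast
    show "frechet_derivative f (at x) = frechet_derivative g (at x)"
      by (rule frechet_derivative_at[OF g])
    show "g differentiable (at x)" using g by (rule differentiableI)
  qed
  have "times_differentiable_on k U (\<lambda>x. frechet_derivative g (at x) v)" for v
    by (rule Suc.IH[where f = "\<lambda>x. frechet_derivative f (at x) v"]) (use Suc.prems eq in auto)
  then show ?case using d by simp
qed

lemma times_differentiable_on_SucI:
  assumes "open U" "\<And>x. x \<in> U \<Longrightarrow> (f has_derivative f' x) (at x)"
    "\<And>v. times_differentiable_on k U (\<lambda>x. f' x v)"
  shows "times_differentiable_on (Suc k) U f"
proof -
  have eq: "f' x = frechet_derivative f (at x)" if "x \<in> U" for x
    using assms(2)[OF that] by (rule frechet_derivative_at)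
  have "times_differentiable_on k U (\<lambda>x. frechet_derivative f (at x) v)" for v
    by (rule times_differentiable_on_cong[OF assms(1) _ assms(3)]) (simp add: eq)
  then show ?thesis using assms(2) by (auto intro: differentiableI)
qed

lemma times_differentiable_on_has_derivative:
  assumes "times_differentiable_on (Suc k) U f" "x \<in> U"
  shows "(f has_derivative frechet_derivative f (at x)) (at x)"
  using assms by (simp add: frechet_derivative_works)

lemma times_differentiable_on_Suc_imp:
  "times_differentiable_on (Suc k) U f \<Longrightarrow> times_differentiable_on k U f"
proof (induction k arbitrary: f)
  case 0
  then show ?case
    by (auto intro!: continuous_at_imp_continuous_on differentiable_imp_continuous_within)
next
  case (Suc k)
  then show ?case by (metis times_differentiable_on.simps(2))
qed

lemma times_differentiable_on_subset:
  "times_differentiable_on k U f \<Longrightarrow> V \<subseteq> U \<Longrightarrow> times_differentiable_on k V f"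
  by (induction k arbitrary: f) (auto intro: continuous_on_subset)

lemma times_differentiable_on_const: "open U \<Longrightarrow> times_differentiable_on k U (\<lambda>x. c)"
proof (induction k arbitrary: c)
  case (Suc k)
  show ?case
    by (rule times_differentiable_on_SucI[where f' = "\<lambda>x v. 0"]) (use Suc in auto)
qed auto

lemma times_differentiable_on_bounded_linear:
  assumes "open U" "bounded_linear f" shows "times_differentiable_on k U f"
proof (cases k)
  case 0
  then show ?thesis using assms by (simp add: linear_continuous_on)
next
  case (Suc k')
  show ?thesis unfolding Suc
    by (rule times_differentiable_on_SucI[where f' = "\<lambda>x. f"])
       (use assms in \<open>auto intro: times_differentiable_on_const bounded_linear_imp_has_derivative\<close>)
qed

lemma times_differentiable_on_add:
  assumes "open U"
  shows "times_differentiable_on k U f \<Longrightarrow> times_differentiable_on k U g \<Longrightarrow>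
    times_differentiable_on k U (\<lambda>x. f x + g x)"
proof (induction k arbitrary: f g)
  case 0
  then show ?case by (simp add: continuous_on_add)
next
  case (Suc k)
  show ?case
  proof (rule times_differentiable_on_SucI[OF assms])
    show "((\<lambda>x. f x + g x) has_derivative
        (\<lambda>v. frechet_derivative f (at x) v + frechet_derivative g (at x) v)) (at x)" if "x \<in> U" for x
      by (intro has_derivative_add times_differentiable_on_has_derivative[OF Suc.prems(1) that]
          times_differentiable_on_has_derivative[OF Suc.prems(2) that])
  qed (use Suc in auto)
qed

lemma times_differentiable_on_bilinear:
  assumes "open U" "bounded_bilinear pr"
  shows "times_differentiable_on k U f \<Longrightarrow> times_differentiable_on k U g \<Longrightarrow>
    times_differentiable_on k U (\<lambda>x. pr (f x) (g x))"
proof (induction k arbitrary: f g)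
  case 0
  then show ?case by (auto intro: bounded_bilinear.continuous_on[OF assms(2)])
next
  case (Suc k)
  show ?case
  proof (rule times_differentiable_on_SucI[OF assms(1)])
    fix x assume "x \<in> U"
    then show "((\<lambda>x. pr (f x) (g x)) has_derivative
        (\<lambda>v. pr (f x) (frechet_derivative g (at x) v) + pr (frechet_derivative f (at x) v) (g x)))
        (at x)"
      by (intro bounded_bilinear.FDERIV[OF assms(2)] times_differentiable_on_has_derivative[OF Suc.prems(1)]
          times_differentiable_on_has_derivative[OF Suc.prems(2)])
  next
    fix v
    show "times_differentiable_on k U (\<lambda>x. pr (f x) (frechet_derivative g (at x) v) +
        pr (frechet_derivative f (at x) v) (g x))"
      using Suc.prems(1)[unfolded times_differentiable_on.simps] Suc.prems(2)[unfolded times_differentiable_on.simps]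
        times_differentiable_on_Suc_imp[OF Suc.prems(1)] times_differentiable_on_Suc_imp[OF Suc.prems(2)]
      by (intro times_differentiable_on_add[OF assms(1)] Suc.IH) auto
  qed
qed

lemma times_differentiable_on_sum:
  assumes "open U" "\<And>i. i \<in> I \<Longrightarrow> times_differentiable_on k U (f i)"
  shows "times_differentiable_on k U (\<lambda>x. \<Sum>i\<in>I. f i x)"
  using assms
  by (induction I rule: infinite_finite_induct)
     (auto intro: times_differentiable_on_const times_differentiable_on_add)

lemma linear_expand_Basis:
  assumes "linear f" shows "f v = (\<Sum>b\<in>Basis. (v \<bullet> b) *\<^sub>R f b)"
  using euclidean_representation[of v] assms
  by (metis (no_types, lifting) linear_scale linear_sum sum.cong)

text \<open>The derivative of the outer map is expanded in the basis: the induction hypothesis applies to its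
  partial derivatives, which are taken in directions that do not depend on the point.\<close>

lemma times_differentiable_on_compose:
  assumes "open U" "open V"
  shows "times_differentiable_on k V f \<Longrightarrow> times_differentiable_on k U g \<Longrightarrow> g ` U \<subseteq> V \<Longrightarrow>
    times_differentiable_on k U (\<lambda>x. f (g x))"
proof (induction k arbitrary: f)
  case 0
  then show ?case by (auto intro: continuous_on_compose2)
next
  case (Suc k)
  have f: "(f has_derivative frechet_derivative f (at (g x))) (at (g x))"
    and g: "(g has_derivative frechet_derivative g (at x)) (at x)" if "x \<in> U" for x
    using times_differentiable_on_has_derivative[OF Suc.prems(1)]
      times_differentiable_on_has_derivative[OF Suc.prems(2)] Suc.prems(3) that by blast+
  show ?case
  proof (rule times_differentiable_on_SucI[OF assms(1)])
    fix x assume x: "x \<in> U"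
    show "((\<lambda>x. f (g x)) has_derivative
       (\<lambda>v. \<Sum>b\<in>Basis. (frechet_derivative g (at x) v \<bullet> b) *\<^sub>R frechet_derivative f (at (g x)) b)) (at x)"
      by (rule has_derivative_eq_rhs[OF diff_chain_at[OF g[OF x] f[OF x], unfolded o_def]])
         (rule ext, rule linear_expand_Basis[OF has_derivative_linear[OF f[OF x]]])
  next
    fix v
    show "times_differentiable_on k U
        (\<lambda>x. \<Sum>b\<in>Basis. (frechet_derivative g (at x) v \<bullet> b) *\<^sub>R frechet_derivative f (at (g x)) b)"
    proof (intro times_differentiable_on_sum[OF assms(1)]
        times_differentiable_on_bilinear[OF assms(1) bounded_bilinear_scaleR]
        times_differentiable_on_bilinear[OF assms(1) bounded_bilinear_inner]
        times_differentiable_on_const[OF assms(1)] Suc.IH)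
      show "times_differentiable_on k U (\<lambda>x. frechet_derivative g (at x) v)"
        using Suc.prems by simp
      show "times_differentiable_on k V (\<lambda>x. frechet_derivative f (at x) b)" for b
        using Suc.prems by simp
    qed (use Suc.prems(3) times_differentiable_on_Suc_imp[OF Suc.prems(2)] in auto)
  qed
qed

text \<open>Raises the order by one, which is what an induction needs when the derivative of a function is an
  expression in the function itself, as for the exponential, the inverse or the square root.\<close>

lemma times_differentiable_on_realI:
  fixes f :: "real \<Rightarrow> real"
  assumes "open U" "\<And>x. x \<in> U \<Longrightarrow> (f has_real_derivative f' x) (at x)" "times_differentiable_on k U f'"
  shows "times_differentiable_on (Suc k) U f"
proof (rule times_differentiable_on_SucI[OF assms(1), where f' = "\<lambda>x v. f' x * v"])
  show "(f has_derivative (*) (f' x)) (at x)" if "x \<in> U" for x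
    using assms(2)[OF that] by (simp add: has_field_derivative_def)
  show "times_differentiable_on k U (\<lambda>x. f' x * v)" for v
    by (intro times_differentiable_on_bilinear[OF assms(1) bounded_bilinear_mult] assms(3)
        times_differentiable_on_const[OF assms(1)])
qed

lemma smooth_on_cong:
  "open U \<Longrightarrow> (\<And>x. x \<in> U \<Longrightarrow> f x = g x) \<Longrightarrow> smooth_on U f \<Longrightarrow> smooth_on U g"
  unfolding smooth_on_def using times_differentiable_on_cong by blast

lemma smooth_on_subset: "smooth_on U f \<Longrightarrow> V \<subseteq> U \<Longrightarrow> smooth_on V f"
  unfolding smooth_on_def using times_differentiable_on_subset by blast

lemma smooth_on_has_derivative:
  "smooth_on U f \<Longrightarrow> x \<in> U \<Longrightarrow> (f has_derivative frechet_derivative f (at x)) (at x)"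
  unfolding smooth_on_def by (blast intro: times_differentiable_on_has_derivative)

lemma smooth_on_imp_continuous_on: "smooth_on U f \<Longrightarrow> continuous_on U f"
  unfolding smooth_on_def by (metis times_differentiable_on.simps(1))

lemma smooth_on_frechet_derivative:
  "smooth_on U f \<Longrightarrow> smooth_on U (\<lambda>x. frechet_derivative f (at x) v)"
  unfolding smooth_on_def by (metis times_differentiable_on.simps(2))

lemma smooth_on_const [intro, simp]: "open U \<Longrightarrow> smooth_on U (\<lambda>x. c)"
  by (simp add: smooth_on_def times_differentiable_on_const)

lemma smooth_on_bounded_linear: "open U \<Longrightarrow> bounded_linear f \<Longrightarrow> smooth_on U f"
  by (simp add: smooth_on_def times_differentiable_on_bounded_linear)

lemma smooth_on_id [intro, simp]: "open U \<Longrightarrow> smooth_on U (\<lambda>x. x)"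
  by (rule smooth_on_bounded_linear) (auto intro: bounded_linear_ident)

lemma smooth_on_add:
  "open U \<Longrightarrow> smooth_on U f \<Longrightarrow> smooth_on U g \<Longrightarrow> smooth_on U (\<lambda>x. f x + g x)"
  by (simp add: smooth_on_def times_differentiable_on_add)

lemma smooth_on_sum:
  "open U \<Longrightarrow> (\<And>i. i \<in> I \<Longrightarrow> smooth_on U (f i)) \<Longrightarrow> smooth_on U (\<lambda>x. \<Sum>i\<in>I. f i x)"
  by (simp add: smooth_on_def times_differentiable_on_sum)

lemma smooth_on_scaleR:
  "open U \<Longrightarrow> smooth_on U f \<Longrightarrow> smooth_on U g \<Longrightarrow> smooth_on U (\<lambda>x. f x *\<^sub>R g x)"
  by (simp add: smooth_on_def times_differentiable_on_bilinear[OF _ bounded_bilinear_scaleR])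

lemma smooth_on_mult:
  fixes f g :: "'a::euclidean_space \<Rightarrow> real"
  shows "open U \<Longrightarrow> smooth_on U f \<Longrightarrow> smooth_on U g \<Longrightarrow> smooth_on U (\<lambda>x. f x * g x)"
  using smooth_on_scaleR[of U f g] by simp

lemma smooth_on_inner:
  "open U \<Longrightarrow> smooth_on U f \<Longrightarrow> smooth_on U g \<Longrightarrow> smooth_on U (\<lambda>x. f x \<bullet> g x)"
  by (simp add: smooth_on_def times_differentiable_on_bilinear[OF _ bounded_bilinear_inner])

lemma smooth_on_compose:
  "smooth_on V f \<Longrightarrow> open U \<Longrightarrow> open V \<Longrightarrow> smooth_on U g \<Longrightarrow> g ` U \<subseteq> V \<Longrightarrow>
    smooth_on U (\<lambda>x. f (g x))"
  by (simp add: smooth_on_def times_differentiable_on_compose)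

lemma smooth_on_compose_UNIV:
  "smooth_on UNIV f \<Longrightarrow> open U \<Longrightarrow> smooth_on U g \<Longrightarrow> smooth_on U (\<lambda>x. f (g x))"
  by (rule smooth_on_compose) auto

lemma smooth_on_uminus: "open U \<Longrightarrow> smooth_on U f \<Longrightarrow> smooth_on U (\<lambda>x. - f x)"
  using smooth_on_scaleR[of U "\<lambda>x. -1" f] by simp

lemma smooth_on_diff:
  "open U \<Longrightarrow> smooth_on U f \<Longrightarrow> smooth_on U g \<Longrightarrow> smooth_on U (\<lambda>x. f x - g x)"
  using smooth_on_add[of U f "\<lambda>x. - g x"] by (simp add: smooth_on_uminus)

lemma smooth_on_power:
  fixes f :: "'a::euclidean_space \<Rightarrow> real"
  shows "open U \<Longrightarrow> smooth_on U f \<Longrightarrow> smooth_on U (\<lambda>x. f x ^ k)"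
  by (induction k) (auto intro: smooth_on_mult)

lemma smooth_on_vec_nth: "open U \<Longrightarrow> smooth_on U f \<Longrightarrow> smooth_on U (\<lambda>x. f x $ i)"
  for f :: "'a::euclidean_space \<Rightarrow> real^'n"
  by (rule smooth_on_compose_UNIV) (auto intro: smooth_on_bounded_linear bounded_linear_vec_nth)

lemma smooth_on_realI:
  fixes f :: "real \<Rightarrow> real"
  assumes "open U" "\<And>x. x \<in> U \<Longrightarrow> (f has_real_derivative f' x) (at x)" "smooth_on U f'"
  shows "smooth_on U f"
proof -
  have "times_differentiable_on (Suc k) U f" for k
    by (rule times_differentiable_on_realI[OF assms(1,2)]) (use assms(3) in \<open>auto simp: smooth_on_def\<close>)
  then show ?thesis unfolding smooth_on_def by (blast intro: times_differentiable_on_Suc_imp)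
qed

lemma smooth_on_exp_real: "smooth_on UNIV (exp :: real \<Rightarrow> real)"
  unfolding smooth_on_def
proof
  show "times_differentiable_on k UNIV (exp :: real \<Rightarrow> real)" for k
  proof (induction k)
    case (Suc k)
    show ?case by (rule times_differentiable_on_realI[OF _ DERIV_exp Suc]) auto
  qed (simp add: continuous_on_exp)
qed

lemma smooth_on_sin_cos_real: "smooth_on UNIV (sin :: real \<Rightarrow> real)" "smooth_on UNIV (cos :: real \<Rightarrow> real)"
proof -
  have "times_differentiable_on k UNIV (sin :: real \<Rightarrow> real) \<and>
      times_differentiable_on k UNIV (cos :: real \<Rightarrow> real)" for k
  proof (induction k)
    case (Suc k)
    have "times_differentiable_on k UNIV (\<lambda>x::real. (-1) *\<^sub>R sin x)"
      using Suc by (intro times_differentiable_on_bilinear[OF _ bounded_bilinear_scaleR]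
          times_differentiable_on_const) auto
    then show ?case
      using Suc times_differentiable_on_realI[OF open_UNIV DERIV_sin, of k]
        times_differentiable_on_realI[OF open_UNIV DERIV_cos, of k] by (simp del: times_differentiable_on.simps)
  qed (simp add: continuous_on_sin continuous_on_cos)
  then show "smooth_on UNIV (sin :: real \<Rightarrow> real)" "smooth_on UNIV (cos :: real \<Rightarrow> real)"
    by (auto simp: smooth_on_def)
qed

lemma smooth_on_inverse_real: "smooth_on (- {0}) (inverse :: real \<Rightarrow> real)"
  unfolding smooth_on_def
proof
  show "times_differentiable_on k (- {0}) (inverse :: real \<Rightarrow> real)" for k
  proof (induction k)
    case (Suc k)
    show ?case
    proof (rule times_differentiable_on_realI)
      show "(inverse has_real_derivative (-1) *\<^sub>R (inverse x *\<^sub>R inverse x)) (at x)" if "x \<in> - {0}" for x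
        using DERIV_inverse[of x UNIV] that by simp
      show "times_differentiable_on k (- {0}) (\<lambda>x::real. (-1) *\<^sub>R (inverse x *\<^sub>R inverse x))"
        by (intro times_differentiable_on_bilinear[OF _ bounded_bilinear_scaleR] Suc
          times_differentiable_on_const) auto
    qed auto
  qed (simp add: continuous_on_inverse)
qed

lemma smooth_on_inverse:
  fixes f :: "'a::euclidean_space \<Rightarrow> real"
  shows "open U \<Longrightarrow> smooth_on U f \<Longrightarrow> (\<And>x. x \<in> U \<Longrightarrow> f x \<noteq> 0) \<Longrightarrow> smooth_on U (\<lambda>x. inverse (f x))"
  by (rule smooth_on_compose[OF smooth_on_inverse_real]) auto

lemma smooth_on_divide:
  fixes f :: "'a::euclidean_space \<Rightarrow> real"
  shows "open U \<Longrightarrow> smooth_on U f \<Longrightarrow> smooth_on U g \<Longrightarrow> (\<And>x. x \<in> U \<Longrightarrow> g x \<noteq> 0) \<Longrightarrow>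
    smooth_on U (\<lambda>x. f x / g x)"
  unfolding divide_inverse by (intro smooth_on_mult smooth_on_inverse)

lemma smooth_on_sqrt_real: "smooth_on {0<..} sqrt"
  unfolding smooth_on_def
proof
  show "times_differentiable_on k {0<..} sqrt" for k
  proof (induction k)
    case (Suc k)
    show ?case
    proof (rule times_differentiable_on_realI)
      show "(sqrt has_real_derivative (1/2) *\<^sub>R inverse (sqrt x)) (at x)" if "x \<in> {0<..}" for x
        using DERIV_real_sqrt[of x] that by (simp add: field_simps)
      show "times_differentiable_on k {0<..} (\<lambda>x::real. (1/2) *\<^sub>R inverse (sqrt x))"
      proof (rule times_differentiable_on_bilinear[OF _ bounded_bilinear_scaleR])
        show "times_differentiable_on k {0<..} (\<lambda>x. inverse (sqrt x))"
          using smooth_on_inverse_real unfolding smooth_on_def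
          by (intro times_differentiable_on_compose[where V = "- {0}" and f = inverse, OF _ _ _ Suc]) auto
      qed (simp_all add: times_differentiable_on_const)
    qed auto
  qed (simp add: continuous_on_real_sqrt)
qed

lemma smooth_on_sqrt:
  "open U \<Longrightarrow> smooth_on U f \<Longrightarrow> (\<And>x. x \<in> U \<Longrightarrow> f x > 0) \<Longrightarrow> smooth_on U (\<lambda>x. sqrt (f x))"
  by (rule smooth_on_compose[OF smooth_on_sqrt_real]) auto

lemma smooth_on_ln_real: "smooth_on {0<..} (ln :: real \<Rightarrow> real)"
  by (rule smooth_on_realI[where f' = inverse])
     (auto intro: smooth_on_inverse DERIV_ln)

lemma smooth_on_arctan: "smooth_on UNIV arctan"
  by (rule smooth_on_realI[where f' = "\<lambda>x. inverse (1 + x\<^sup>2)"])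
     (auto intro!: smooth_on_inverse smooth_on_add smooth_on_power smooth_on_id smooth_on_const DERIV_arctan
        simp: add_nonneg_eq_0_iff)

lemmas smooth_on_exp = smooth_on_compose_UNIV[OF smooth_on_exp_real]
lemmas smooth_on_sin = smooth_on_compose_UNIV[OF smooth_on_sin_cos_real(1)]
lemmas smooth_on_cos = smooth_on_compose_UNIV[OF smooth_on_sin_cos_real(2)]

lemma inner_vector_3: "vector [a, b, c] \<bullet> (vector [d, e, f] :: real^3) = a * d + b * e + c * f"
  by (simp add: inner_vec_def sum_3)

lemma vector_3_expand: "(vector [a, b, c] :: real^3) = a *\<^sub>R axis 1 1 + b *\<^sub>R axis 2 1 + c *\<^sub>R axis 3 1"
  by (simp add: vec_eq_iff forall_3 axis_def)

lemma vector_2_expand: "(vector [a, b] :: real^2) = a *\<^sub>R axis 1 1 + b *\<^sub>R axis 2 1"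
  by (simp add: vec_eq_iff forall_2 axis_def)

lemma smooth_on_vector_3:
  "open U \<Longrightarrow> smooth_on U a \<Longrightarrow> smooth_on U b \<Longrightarrow> smooth_on U c \<Longrightarrow>
    smooth_on U (\<lambda>x. vector [a x, b x, c x] :: real^3)"
  unfolding vector_3_expand by (intro smooth_on_add smooth_on_scaleR smooth_on_const)

lemma smooth_on_vector_2:
  "open U \<Longrightarrow> smooth_on U a \<Longrightarrow> smooth_on U b \<Longrightarrow> smooth_on U (\<lambda>x. vector [a x, b x] :: real^2)"
  unfolding vector_2_expand by (intro smooth_on_add smooth_on_scaleR smooth_on_const)

lemmas smooth_on_intros = smooth_on_const smooth_on_id smooth_on_add smooth_on_scaleR smooth_on_mult smooth_on_diff
  smooth_on_uminus smooth_on_power smooth_on_vec_nth smooth_on_exp smooth_on_sin smooth_on_cos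
  smooth_on_vector_3 smooth_on_vector_2 smooth_on_inner smooth_on_divide

lemma vec_nth_deriv [derivative_intros]:
  "((\<lambda>x::real^'n. x $ k) has_derivative (\<lambda>h. h $ k)) (at x)"
  by (rule bounded_linear_imp_has_derivative) (rule bounded_linear_vec_nth)

section \<open>Iterated derivatives along a vector field\<close>

lemma smooth_on_dir_deriv:
  assumes "open N" "smooth_on N \<eta>" "smooth_on N f"
  shows "smooth_on N (dir_deriv \<eta> f)"
proof (rule smooth_on_cong[OF assms(1)])
  show "(\<Sum>b\<in>Basis. (\<eta> x \<bullet> b) *\<^sub>R frechet_derivative f (at x) b) = dir_deriv \<eta> f x" if "x \<in> N" for x
    unfolding dir_deriv_def
    using linear_expand_Basis[OF has_derivative_linear[OF smooth_on_has_derivative[OF assms(3) that]]]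
    by metis
  show "smooth_on N (\<lambda>x. \<Sum>b\<in>Basis. (\<eta> x \<bullet> b) *\<^sub>R frechet_derivative f (at x) b)"
    by (intro smooth_on_sum smooth_on_scaleR smooth_on_inner smooth_on_const smooth_on_frechet_derivative assms)
qed

lemma smooth_on_funpow_dir_deriv:
  assumes "open N" "smooth_on N \<eta>" "smooth_on N f"
  shows "smooth_on N ((dir_deriv \<eta> ^^ k) f)"
  by (induction k) (use assms in \<open>auto intro: smooth_on_dir_deriv\<close>)

lemma dir_deriv_eqI:
  "(f has_derivative f') (at x) \<Longrightarrow> dir_deriv \<eta> f x = f' (\<eta> x)"
  unfolding dir_deriv_def using frechet_derivative_at by metis

lemma dir_deriv_cong:
  assumes "open N" "y \<in> N" "\<And>x. x \<in> N \<Longrightarrow> f x = g x"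
  shows "dir_deriv \<eta> f y = dir_deriv \<eta> g y"
proof -
  have "(f has_derivative D) (at y) \<longleftrightarrow> (g has_derivative D) (at y)" for D
    using has_derivative_transform_within_open[OF _ assms(1,2)] assms(3) by metis
  then show ?thesis by (simp add: dir_deriv_def frechet_derivative_def)
qed

lemma funpow_dir_deriv_cong:
  assumes "open N" "\<And>x. x \<in> N \<Longrightarrow> f x = g x"
  shows "y \<in> N \<Longrightarrow> (dir_deriv \<eta> ^^ k) f y = (dir_deriv \<eta> ^^ k) g y"
proof (induction k arbitrary: y)
  case (Suc k)
  show ?case
    using dir_deriv_cong[OF assms(1) Suc.prems, of "(dir_deriv \<eta> ^^ k) f" "(dir_deriv \<eta> ^^ k) g" \<eta>] Suc.IH by simp
qed (use assms in auto)

lemma dir_deriv_add: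
  assumes "smooth_on N f" "smooth_on N g" "y \<in> N"
  shows "dir_deriv \<eta> (\<lambda>x. f x + g x) y = dir_deriv \<eta> f y + dir_deriv \<eta> g y"
  using dir_deriv_eqI[OF has_derivative_add[OF smooth_on_has_derivative[OF assms(1,3)]
    smooth_on_has_derivative[OF assms(2,3)]]]
  by (simp add: dir_deriv_def)

lemma dir_deriv_scaleR:
  assumes "smooth_on N f" "smooth_on N g" "y \<in> N"
  shows "dir_deriv \<eta> (\<lambda>x. f x *\<^sub>R g x) y = f y *\<^sub>R dir_deriv \<eta> g y + dir_deriv \<eta> f y *\<^sub>R g y"
  using dir_deriv_eqI[OF has_derivative_scaleR[OF smooth_on_has_derivative[OF assms(1,3)]
    smooth_on_has_derivative[OF assms(2,3)]]]
  by (simp add: dir_deriv_def)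

lemma dir_deriv_linear:
  assumes "smooth_on N f" "bounded_linear L" "y \<in> N"
  shows "dir_deriv \<eta> (\<lambda>x. L (f x)) y = L (dir_deriv \<eta> f y)"
  using dir_deriv_eqI[OF bounded_linear.has_derivative[OF assms(2) smooth_on_has_derivative[OF assms(1,3)]]]
  by (simp add: dir_deriv_def)

lemma funpow_dir_deriv_linear:
  assumes "open N" "smooth_on N \<eta>" "smooth_on N f" "bounded_linear L"
  shows "y \<in> N \<Longrightarrow> (dir_deriv \<eta> ^^ k) (\<lambda>x. L (f x)) y = L ((dir_deriv \<eta> ^^ k) f y)"
proof (induction k arbitrary: y)
  case (Suc k)
  have "(dir_deriv \<eta> ^^ Suc k) (\<lambda>x. L (f x)) y = dir_deriv \<eta> (\<lambda>x. L ((dir_deriv \<eta> ^^ k) f x)) y"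
    by (simp, rule dir_deriv_cong[OF assms(1) Suc.prems Suc.IH])
  also have "\<dots> = L ((dir_deriv \<eta> ^^ Suc k) f y)"
    using dir_deriv_linear[OF smooth_on_funpow_dir_deriv[OF assms(1-3)] assms(4) Suc.prems] by simp
  finally show ?case .
qed simp

lemma funpow_dir_deriv_add:
  assumes "open N" "smooth_on N \<eta>" "smooth_on N f" "smooth_on N g"
  shows "y \<in> N \<Longrightarrow> (dir_deriv \<eta> ^^ k) (\<lambda>x. f x + g x) y = (dir_deriv \<eta> ^^ k) f y + (dir_deriv \<eta> ^^ k) g y"
proof (induction k arbitrary: y)
  case (Suc k)
  have "(dir_deriv \<eta> ^^ Suc k) (\<lambda>x. f x + g x) y =
      dir_deriv \<eta> (\<lambda>x. (dir_deriv \<eta> ^^ k) f x + (dir_deriv \<eta> ^^ k) g x) y"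
    by (simp, rule dir_deriv_cong[OF assms(1) Suc.prems Suc.IH])
  also have "\<dots> = (dir_deriv \<eta> ^^ Suc k) f y + (dir_deriv \<eta> ^^ Suc k) g y"
    using dir_deriv_add[OF smooth_on_funpow_dir_deriv[OF assms(1-3)]
        smooth_on_funpow_dir_deriv[OF assms(1,2,4)] Suc.prems] by simp
  finally show ?case .
qed simp

text \<open>The order of vanishing at \<open>p\<close> along the integral curve of \<open>\<eta>\<close> through \<open>p\<close>, expressed without
  the flow of \<open>\<eta>\<close>.\<close>
definition vanishes_to_order ::
  "('a::euclidean_space \<Rightarrow> 'a) \<Rightarrow> 'a \<Rightarrow> nat \<Rightarrow> ('a \<Rightarrow> 'b::euclidean_space) \<Rightarrow> bool" where
  "vanishes_to_order \<eta> p m f \<longleftrightarrow> (\<forall>j<m. (dir_deriv \<eta> ^^ j) f p = 0)"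

lemma vanishes_to_order_Suc:
  "vanishes_to_order \<eta> p (Suc m) f \<longleftrightarrow> f p = 0 \<and> vanishes_to_order \<eta> p m (dir_deriv \<eta> f)"
  unfolding vanishes_to_order_def All_less_Suc2 by (simp add: funpow_swap1)

lemma vanishes_to_order_0 [simp]: "vanishes_to_order \<eta> p 0 f"
  by (simp add: vanishes_to_order_def)

lemma vanishes_to_order_cong:
  assumes "open N" "p \<in> N" "\<And>x. x \<in> N \<Longrightarrow> f x = g x"
  shows "vanishes_to_order \<eta> p m f \<longleftrightarrow> vanishes_to_order \<eta> p m g"
  unfolding vanishes_to_order_def using funpow_dir_deriv_cong[OF assms(1,3,2)] by simp

lemma vanishes_to_order_add:
  assumes "open N" "p \<in> N" "smooth_on N \<eta>" "smooth_on N f" "smooth_on N g"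
    "vanishes_to_order \<eta> p m f" "vanishes_to_order \<eta> p m g"
  shows "vanishes_to_order \<eta> p m (\<lambda>x. f x + g x)"
  using assms(6,7) funpow_dir_deriv_add[OF assms(1,3-5,2)] by (simp add: vanishes_to_order_def)

text \<open>Orders of vanishing add up. One derivation of a product gives two products in which a single
  factor has lost one order, so the binomial expansion of higher derivatives is avoided.\<close>

lemma vanishes_to_order_scaleR:
  assumes "open N" "p \<in> N" "smooth_on N \<eta>"
  shows "smooth_on N f \<Longrightarrow> smooth_on N g \<Longrightarrow> vanishes_to_order \<eta> p k f \<Longrightarrow> vanishes_to_order \<eta> p l g \<Longrightarrow>
    m \<le> k + l \<Longrightarrow> vanishes_to_order \<eta> p m (\<lambda>x. f x *\<^sub>R g x)"
proof (induction m arbitrary: k l f g)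
  case (Suc m)
  have zero: "f p *\<^sub>R g p = 0"
    using Suc.prems(3-5) by (cases k; cases l) (auto simp: vanishes_to_order_Suc)
  have lower: "vanishes_to_order \<eta> p (j - 1) (dir_deriv \<eta> h)" if "vanishes_to_order \<eta> p j h"
    for j and h :: "'a \<Rightarrow> 'c::euclidean_space"
    using that by (cases j) (auto simp: vanishes_to_order_Suc)
  have lower': "vanishes_to_order \<eta> p (k - 1) (dir_deriv \<eta> f)"
    using Suc.prems(3) by (cases k) (auto simp: vanishes_to_order_Suc)
  have Df: "smooth_on N (dir_deriv \<eta> f)" and Dg: "smooth_on N (dir_deriv \<eta> g)"
    by (intro smooth_on_dir_deriv assms Suc.prems)+
  have "vanishes_to_order \<eta> p m (\<lambda>x. f x *\<^sub>R dir_deriv \<eta> g x)"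
    using Suc.IH[OF Suc.prems(1) Dg Suc.prems(3) lower[OF Suc.prems(4)]] Suc.prems(5) by simp
  moreover have "vanishes_to_order \<eta> p m (\<lambda>x. dir_deriv \<eta> f x *\<^sub>R g x)"
    using Suc.IH[OF Df Suc.prems(2) lower' Suc.prems(4)] Suc.prems(5) by simp
  ultimately have "vanishes_to_order \<eta> p m (\<lambda>x. f x *\<^sub>R dir_deriv \<eta> g x + dir_deriv \<eta> f x *\<^sub>R g x)"
    by (intro vanishes_to_order_add[OF assms(1-3)] smooth_on_scaleR assms Df Dg Suc.prems)
  then have "vanishes_to_order \<eta> p m (dir_deriv \<eta> (\<lambda>x. f x *\<^sub>R g x))"
    using vanishes_to_order_cong[OF assms(1,2) dir_deriv_scaleR[OF Suc.prems(1,2)]] by simp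
  then show ?case using zero by (simp add: vanishes_to_order_Suc)
qed simp

lemma vanishes_to_order_power:
  fixes u :: "'a::euclidean_space \<Rightarrow> real"
  assumes "open N" "p \<in> N" "smooth_on N \<eta>" "smooth_on N u" "u p = 0"
  shows "vanishes_to_order \<eta> p m (\<lambda>x. u x ^ m)"
proof (induction m)
  case (Suc m)
  have "vanishes_to_order \<eta> p 1 u" using assms(5) by (simp add: vanishes_to_order_def)
  then show ?case
    using vanishes_to_order_scaleR[OF assms(1-4) smooth_on_power[OF assms(1,4)] _ Suc, where k = 1 and m = "Suc m"]
    by simp
qed simp

lemma vanishes_to_order_power_scaleR:
  fixes u :: "'a::euclidean_space \<Rightarrow> real"
  assumes "open N" "p \<in> N" "smooth_on N \<eta>" "smooth_on N u" "u p = 0" "smooth_on N g"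
  shows "vanishes_to_order \<eta> p m (\<lambda>x. u x ^ m *\<^sub>R g x)"
  using vanishes_to_order_scaleR[OF assms(1-3) smooth_on_power[OF assms(1,4)] assms(6)
      vanishes_to_order_power[OF assms(1-5)] vanishes_to_order_0, where m = m and k = m] by simp

lemma dir_deriv_power:
  fixes u :: "'a::euclidean_space \<Rightarrow> real"
  assumes "smooth_on N u" "y \<in> N"
  shows "dir_deriv \<eta> (\<lambda>x. u x ^ Suc m) y = real (Suc m) * u y ^ m * dir_deriv \<eta> u y"
  using dir_deriv_eqI[OF has_derivative_power[OF smooth_on_has_derivative[OF assms], of "Suc m"]]
  by (simp add: dir_deriv_def)

text \<open>The leading Taylor coefficient along the integral curve, where \<open>u\<close> behaves like
  \<open>t\<close> times its derivative.\<close>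

lemma funpow_dir_deriv_power_scaleR:
  fixes u :: "'a::euclidean_space \<Rightarrow> real"
  assumes "open N" "p \<in> N" "smooth_on N \<eta>" "smooth_on N u" "u p = 0"
  shows "smooth_on N g \<Longrightarrow>
    (dir_deriv \<eta> ^^ m) (\<lambda>x. u x ^ m *\<^sub>R g x) p = (fact m * dir_deriv \<eta> u p ^ m) *\<^sub>R g p"
proof (induction m arbitrary: g)
  case (Suc m)
  define h where "h = (\<lambda>x. u x *\<^sub>R dir_deriv \<eta> g x + (real (Suc m) * dir_deriv \<eta> u x) *\<^sub>R g x)"
  have h: "smooth_on N h"
    unfolding h_def
    by (intro smooth_on_add smooth_on_scaleR smooth_on_mult smooth_on_const smooth_on_dir_deriv assms Suc.prems)
  have "dir_deriv \<eta> (\<lambda>x. u x ^ Suc m *\<^sub>R g x) y = u y ^ m *\<^sub>R h y" if "y \<in> N" for y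
    unfolding dir_deriv_scaleR[OF smooth_on_power[OF assms(1,4)] Suc.prems that]
      dir_deriv_power[OF assms(4) that] h_def
    by (simp add: scaleR_add_right mult_ac)
  then have "(dir_deriv \<eta> ^^ m) (dir_deriv \<eta> (\<lambda>x. u x ^ Suc m *\<^sub>R g x)) p =
      (dir_deriv \<eta> ^^ m) (\<lambda>x. u x ^ m *\<^sub>R h x) p"
    by (rule funpow_dir_deriv_cong[OF assms(1) _ assms(2)])
  also have "\<dots> = (fact m * dir_deriv \<eta> u p ^ m) *\<^sub>R h p" by (rule Suc.IH[OF h])
  also have "\<dots> = (fact (Suc m) * dir_deriv \<eta> u p ^ Suc m) *\<^sub>R g p"
    by (simp add: h_def assms(5) algebra_simps)
  finally show ?case by (simp add: funpow_swap1)
qed simp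

section \<open>Moment integrals\<close>

text \<open>For \<open>u \<noteq> 0\<close> this is \<open>u\<close> to the power \<open>- (k + 1)\<close> times the integral of \<open>s^k g(s)\<close> from \<open>0\<close> to \<open>u\<close>.
  Rescaling to the unit interval carries out the division, so that \<open>u = 0\<close> is not exceptional.\<close>
definition moment :: "nat \<Rightarrow> (real \<Rightarrow> real) \<Rightarrow> real \<Rightarrow> real" where
  "moment k g u = integral {0..1} (\<lambda>t. t ^ k * g (t * u))"

lemma smooth_on_real_deriv:
  assumes "smooth_on UNIV (g :: real \<Rightarrow> real)"
  shows "(g has_real_derivative frechet_derivative g (at x) 1) (at x)"
proof -
  have d: "(g has_derivative frechet_derivative g (at x)) (at x)"
    using smooth_on_has_derivative[OF assms] by simp
  have "frechet_derivative g (at x) v = frechet_derivative g (at x) 1 * v" for v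
    using linear_scale[OF has_derivative_linear[OF d], of v 1] by simp
  then have "frechet_derivative g (at x) = (*) (frechet_derivative g (at x) 1)" ..
  then show ?thesis using d by (simp add: has_field_derivative_def)
qed

lemma continuous_on_moment_integrand:
  assumes "continuous_on UNIV (g :: real \<Rightarrow> real)"
  shows "continuous_on S (\<lambda>(u, t). t ^ k * g (t * u))"
  unfolding split_beta
  by (intro continuous_intros continuous_on_compose2[OF assms]) auto

text \<open>Moments of smooth functions are closed under differentiation, whence their smoothness.\<close>

lemma moment_has_derivative:
  assumes "smooth_on UNIV g"
  shows "(moment k g has_real_derivative moment (Suc k) (\<lambda>x. frechet_derivative g (at x) 1) u) (at u)"
proof -
  define g' where "g' = (\<lambda>x. frechet_derivative g (at x) 1)"
  have cg: "continuous_on UNIV g" and cg': "continuous_on UNIV g'"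
    unfolding g'_def using assms by (auto intro: smooth_on_imp_continuous_on smooth_on_frechet_derivative)
  have "((\<lambda>u. integral (cbox 0 1) (\<lambda>t. t ^ k * g (t * u))) has_field_derivative
      integral (cbox 0 1) (\<lambda>t. t ^ Suc k * g' (t * u))) (at u within UNIV)"
  proof (rule leibniz_rule_field_derivative)
    show "((\<lambda>u. t ^ k * g (t * u)) has_real_derivative t ^ Suc k * g' (t * u)) (at u)" for u t
      unfolding g'_def
      by (rule derivative_eq_intros DERIV_chain2[OF smooth_on_real_deriv[OF assms]] refl | simp)+
    show "(\<lambda>t. t ^ k * g (t * u)) integrable_on cbox 0 1" for u
      by (intro integrable_continuous continuous_intros continuous_on_compose2[OF cg]) auto
    show "continuous_on (UNIV \<times> cbox 0 1) (\<lambda>(u, t). t ^ Suc k * g' (t * u))"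
      by (rule continuous_on_moment_integrand[OF cg'])
  qed auto
  then show ?thesis by (simp add: moment_def[abs_def] g'_def)
qed

lemma smooth_on_moment:
  assumes "smooth_on UNIV g"
  shows "smooth_on UNIV (moment k g)"
  unfolding smooth_on_def
proof
  show "times_differentiable_on j UNIV (moment k g)" for j
    using assms
  proof (induction j arbitrary: k g)
    case 0
    have "continuous_on UNIV (\<lambda>u. integral (cbox 0 1) (\<lambda>t. t ^ k * g (t * u)))"
      using smooth_on_imp_continuous_on[OF 0]
      by (intro integral_continuous_on_param continuous_on_moment_integrand)
    then show ?case by (simp add: moment_def[abs_def])
  next
    case (Suc j)
    show ?case
      by (rule times_differentiable_on_realI[OF open_UNIV moment_has_derivative[OF Suc.prems]])
         (rule Suc.IH[OF smooth_on_frechet_derivative[OF Suc.prems]])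
  qed
qed

text \<open>Both sides are the integral over the unit interval of the \<open>t\<close>-derivative of \<open>t^(k+1) g(tu)\<close>.\<close>

lemma moment_ode:
  assumes "smooth_on UNIV g" "(moment k g has_real_derivative d) (at u)"
  shows "real (Suc k) * moment k g u + u * d = g u"
proof -
  define g' where "g' = (\<lambda>x. frechet_derivative g (at x) 1)"
  have cg: "continuous_on UNIV g" and cg': "continuous_on UNIV g'"
    unfolding g'_def using assms by (auto intro: smooth_on_imp_continuous_on smooth_on_frechet_derivative)
  have d: "d = moment (Suc k) g' u"
    using DERIV_unique[OF assms(2) moment_has_derivative[OF assms(1)]] by (simp add: g'_def)
  have 1: "((\<lambda>t. real (Suc k) * (t ^ k * g (t * u)) + u * (t ^ Suc k * g' (t * u)))
      has_integral (1 ^ Suc k * g (1 * u) - 0 ^ Suc k * g (0 * u))) {0..1}"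
  proof (rule fundamental_theorem_of_calculus)
    show "((\<lambda>t. t ^ Suc k * g (t * u)) has_vector_derivative
        real (Suc k) * (t ^ k * g (t * u)) + u * (t ^ Suc k * g' (t * u))) (at t within {0..1})" for t
      unfolding has_real_derivative_iff_has_vector_derivative[symmetric] g'_def
      by (rule derivative_eq_intros DERIV_chain2[OF DERIV_subset[OF smooth_on_real_deriv[OF assms(1)] subset_UNIV]] refl | simp)+
  qed auto
  have "((\<lambda>t. real (Suc k) * (t ^ k * g (t * u)) + u * (t ^ Suc k * g' (t * u)))
      has_integral (real (Suc k) * moment k g u + u * d)) {0..1}"
    unfolding d moment_def
    by (intro has_integral_add has_integral_mult_right integrable_integral integrable_continuous_real
        continuous_intros continuous_on_compose2[OF cg] continuous_on_compose2[OF cg']) auto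
  from has_integral_unique[OF this 1] show ?thesis by simp
qed

section \<open>The plane as an oriented surface\<close>

text \<open>With a single chart, an adapted pair can only be given in the standard coordinates.\<close>
definition plane :: "point manifold" where
  "plane = \<lparr>top_of = euclidean, atlas = {(UNIV, id)}\<rparr>"

lemma inv_into_UNIV_id [simp]: "inv_into UNIV id = id"
  by simp

lemma local_rep_plane [simp]: "local_rep (UNIV, id) f = f"
  by (simp add: local_rep_def)

lemma diff_at_plane [simp]: "diff_at (UNIV, id) f q = frechet_derivative f (at q)"
  by (simp add: diff_at_def)

lemma plane_simps [simp]:
  "top_of plane = euclidean" "atlas plane = {(UNIV, id)}" "charts_at plane q = {(UNIV, id)}"
  by (auto simp: plane_def charts_at_def)

lemma coordinate_chart_plane: "coordinate_chart euclidean (UNIV, id)"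
  by (simp add: coordinate_chart_def)

lemma positive_transition_plane: "positive_transition (UNIV, id) (UNIV, id :: real^2 \<Rightarrow> real^2)"
proof -
  have "frechet_derivative id (at x) = id" for x :: "real^2"
    by (rule frechet_derivative_at[symmetric]) (rule has_derivative_id)
  then have "jacobian id (at x) = mat 1" for x :: "real^2"
    by (simp add: jacobian_def matrix_def mat_def id_def vec_eq_iff axis_def)
  moreover have "smooth_on UNIV (id :: real^2 \<Rightarrow> real^2)"
    by (simp add: id_def)
  ultimately show ?thesis
    by (simp add: positive_transition_def det_I)
qed

lemma second_countable_euclidean: "second_countable (euclidean :: 'a::second_countable_topology topology)"
proof -
  obtain B :: "'a set set" where B: "countable B" "topological_basis B"
    using ex_countable_basis by metis
  have "\<exists>V\<in>B. x \<in> V \<and> V \<subseteq> U" if "open U" "x \<in> U" for U x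
    by (rule topological_basisE[OF B(2) that]) blast
  then show ?thesis
    unfolding second_countable_def
    using B(1) topological_basis_open[OF B(2)] by (intro exI[of _ B]) simp
qed

lemma oriented_2_manifold_plane: "oriented_2_manifold plane"
  using coordinate_chart_plane positive_transition_plane
  by (simp add: oriented_2_manifold_def second_countable_euclidean)

lemma standard_chart_oriented: "(UNIV, id) \<in> oriented_coords_at plane p"
  using coordinate_chart_plane positive_transition_plane by (simp add: oriented_coords_at_def)

lemma smooth_map_plane [simp]: "smooth_map plane D f \<longleftrightarrow> smooth_on D f"
  by (simp add: smooth_map_def)

lemma diffeo_of_plane_translation: "diffeo_of plane UNIV (\<lambda>x. x + c)"
proof -
  have inv: "inv_into UNIV (\<lambda>x. x + c) = (\<lambda>x. x - c)"
    by (rule inv_equality) auto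
  have "homeomorphic_map euclidean euclidean (\<lambda>x. x + c)"
    by (rule homeomorphic_maps_imp_map[where g = "\<lambda>x. x - c"])
       (auto simp: homeomorphic_maps_def intro!: continuous_intros)
  then show ?thesis
    by (auto simp: diffeo_of_def inv intro!: smooth_on_add smooth_on_diff)
qed

lemma singular_set_plane: "singular_set plane f = {p. \<not> inj (frechet_derivative f (at p))}"
  by (simp add: singular_set_def)

lemma diffeo_germI:
  assumes "open U" "open V" "p \<in> U" "\<Psi> p = q"
    and maps: "\<And>y. y \<in> U \<Longrightarrow> \<Psi> y \<in> V" "\<And>w. w \<in> V \<Longrightarrow> \<Theta> w \<in> U"
    and inverse: "\<And>y. y \<in> U \<Longrightarrow> \<Theta> (\<Psi> y) = y" "\<And>w. w \<in> V \<Longrightarrow> \<Psi> (\<Theta> w) = w"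
    and smooth: "smooth_on U \<Psi>" "smooth_on V \<Theta>"
  shows "diffeo_germ \<Psi> p q"
proof -
  have bij: "bij_betw \<Psi> U V"
    by (rule bij_betw_byWitness[where f' = \<Theta>]) (use maps inverse in auto)
  have "inv_into U \<Psi> w = \<Theta> w" if "w \<in> V" for w
    using that maps inverse bij by (metis bij_betw_def inv_into_f_eq)
  then have "smooth_on V (inv_into U \<Psi>)"
    using smooth_on_cong[OF assms(2) _ smooth(2)] by metis
  then show ?thesis unfolding diffeo_germ_def using assms(1-4) bij smooth(1) by blast
qed

section \<open>Surfaces of revolution with an edge\<close>

definition rotation :: "real \<Rightarrow> real^3 \<Rightarrow> real^3" where
  "rotation t y = vector [cos t * y$1 - sin t * y$2, sin t * y$1 + cos t * y$2, y$3]"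

lemma helicoidal_motion_rotation: "helicoidal_motion rotation"
proof -
  have "(dist (rotation t x) (rotation t y))\<^sup>2 = (dist x y)\<^sup>2" for t x y
    using sin_cos_squared_add[of t]
    unfolding dist_norm power2_norm_eq_inner rotation_def inner_vec_def sum_3 inner_real_def
      vector_minus_component vector_3
    by algebra
  then have "dist (rotation t x) (rotation t y) = dist x y" for t x y
    by (simp add: power2_eq_iff_nonneg)
  moreover have "rotation 0 = id"
    by (simp add: rotation_def fun_eq_iff vec_eq_iff forall_3)
  moreover have "rotation (s + t) = rotation s \<circ> rotation t" for s t
    by (simp add: rotation_def fun_eq_iff vec_eq_iff forall_3 cos_add sin_add algebra_simps)
  moreover have "continuous_on UNIV (\<lambda>t. rotation t x)" for x
    unfolding rotation_def vector_3_expand by (intro continuous_intros)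
  moreover have "rotation pi \<noteq> id"
  proof
    assume "rotation pi = id"
    then have "rotation pi (axis 1 1) $ 1 = axis 1 1 $ 1" by simp
    then show False by (simp add: rotation_def)
  qed
  ultimately show ?thesis unfolding helicoidal_motion_def by blast
qed

text \<open>The radius of rotation never vanishes, and the logarithm of its quotient by \<open>m\<close> is exactly \<open>u^n\<close>, the
  first coordinate of the normal form of an edge. The first term of the height is proportional to
  the radius, so a non-zero \<open>a\<close> is what makes the meridian deviate from a straight line.\<close>
definition edge :: "nat \<Rightarrow> nat \<Rightarrow> real \<Rightarrow> real \<Rightarrow> (real \<Rightarrow> real) \<Rightarrow> real^2 \<Rightarrow> real^3" where
  "edge n i m \<rho> a x = vector
     [m * exp (x$1 ^ n) * cos (x$2 / m), m * exp (x$1 ^ n) * sin (x$2 / m),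
      \<rho> * exp (x$1 ^ n) + x$1 ^ (n + i) * a (x$1)]"

locale revolution_edge =
  fixes n i :: nat and m \<rho> :: real and a :: "real \<Rightarrow> real"
  assumes n: "2 \<le> n" and i: "1 \<le> i" and m: "0 < m" and \<rho>: "0 < \<rho>" and a: "smooth_on UNIV a"
begin

abbreviation F :: "real^2 \<Rightarrow> real^3" where "F \<equiv> edge n i m \<rho> a"

text \<open>The \<open>u\<close>-derivative of \<open>e^(u^n)\<close>, which also divides the derivative of the height; the quotient
  is \<open>slope\<close>, a smooth function even at the singular points.\<close>
definition speed :: "real \<Rightarrow> real" where
  "speed u = real n * u ^ (n - 1) * exp (u ^ n)"

definition slope :: "real \<Rightarrow> real" where
  "slope u = \<rho> + u ^ i * ((real (n + i) * a u + u * frechet_derivative a (at u) 1) * exp (- (u ^ n)) / real n)"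

definition meridian :: "real^2 \<Rightarrow> real^3" where
  "meridian x = vector [m * cos (x$2 / m), m * sin (x$2 / m), slope (x$1)]"

definition parallel :: "real^2 \<Rightarrow> real^3" where
  "parallel x = vector [- exp (x$1 ^ n) * sin (x$2 / m), exp (x$1 ^ n) * cos (x$2 / m), 0]"

definition normal :: "real^2 \<Rightarrow> real^3" where
  "normal x = (1 / sqrt ((slope (x$1))\<^sup>2 + m\<^sup>2)) *\<^sub>R
     vector [slope (x$1) * cos (x$2 / m), slope (x$1) * sin (x$2 / m), - m]"

lemma a_deriv: "(a has_real_derivative frechet_derivative a (at u) 1) (at u)"
  by (rule smooth_on_real_deriv[OF a])

lemma height_deriv:
  "((\<lambda>u. \<rho> * exp (u ^ n) + u ^ (n + i) * a u) has_real_derivative speed u * slope u) (at u)"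
proof -
  define B where "B = real (n + i) * a u + u * frechet_derivative a (at u) 1"
  have e: "exp (u ^ n) * exp (- (u ^ n)) = 1" by (simp flip: exp_add)
  have p: "u ^ (n - 1) * u ^ i = u ^ (n + i - 1)" "u ^ (n + i) = u * u ^ (n + i - 1)"
    using n by (simp_all flip: power_add power_Suc)
  have "speed u * slope u =
      real n * u ^ (n - 1) * exp (u ^ n) * \<rho> + (u ^ (n - 1) * u ^ i) * B * (exp (u ^ n) * exp (- (u ^ n)))"
    unfolding speed_def slope_def B_def[symmetric] using n by (simp add: field_simps)
  then have *: "speed u * slope u = \<rho> * (exp (u ^ n) * (real n * u ^ (n - 1))) +
      (real (n + i) * u ^ (n + i - 1) * a u + frechet_derivative a (at u) 1 * u ^ (n + i))"
    unfolding e p B_def by (simp add: algebra_simps)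
  show ?thesis
    unfolding *
    by (rule derivative_eq_intros a_deriv refl | simp)+
qed

lemma smooth_slope: "smooth_on UNIV slope"
  unfolding slope_def[abs_def]
  by (intro smooth_on_intros a smooth_on_frechet_derivative open_UNIV) (use n in auto)

lemma smooth_slope_comp: "open U \<Longrightarrow> smooth_on U (\<lambda>x. slope (x$1))" for U :: "(real^2) set"
  by (rule smooth_on_compose_UNIV[OF smooth_slope]) (auto intro: smooth_on_vec_nth)

lemma smooth_F: "smooth_on UNIV F"
  unfolding edge_def[abs_def]
  by (intro smooth_on_intros smooth_on_compose_UNIV[OF a] open_UNIV) (use m in auto)

lemma exp_power_deriv:
  "((\<lambda>x::real^2. exp (x$1 ^ n)) has_derivative (\<lambda>h. h$1 * speed (x$1))) (at x)"
proof -
  have "((\<lambda>u. exp (u ^ n)) has_real_derivative speed u) (at u)" for u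
    unfolding speed_def by (rule derivative_eq_intros refl | simp)+
  from has_derivative_compose[OF vec_nth_deriv this[unfolded has_field_derivative_def]]
  show ?thesis by (simp add: mult.commute)
qed

lemma angle_deriv:
  "((\<lambda>x::real^2. cos (x$2 / m)) has_derivative (\<lambda>h. h$2 * (- sin (x$2 / m) / m))) (at x)"
  "((\<lambda>x::real^2. sin (x$2 / m)) has_derivative (\<lambda>h. h$2 * (cos (x$2 / m) / m))) (at x)"
  by (rule derivative_eq_intros refl | use m in simp)+

lemma F_has_derivative:
  "(F has_derivative (\<lambda>h. (h$1 * speed (x$1)) *\<^sub>R meridian x + h$2 *\<^sub>R parallel x)) (at x)"
proof -
  have E: "((\<lambda>x::real^2. m * exp (x$1 ^ n)) has_derivative (\<lambda>h. h$1 * (m * speed (x$1)))) (at x)"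
    using has_derivative_mult_right[OF exp_power_deriv, of m] by (simp add: mult_ac)
  have H: "((\<lambda>x::real^2. \<rho> * exp (x$1 ^ n) + x$1 ^ (n + i) * a (x$1)) has_derivative
      (\<lambda>h. h$1 * (speed (x$1) * slope (x$1)))) (at x)"
    using has_derivative_compose[OF vec_nth_deriv height_deriv[unfolded has_field_derivative_def]]
    by (simp add: mult.commute)
  show ?thesis
    unfolding edge_def[abs_def] vector_3_expand
    by (rule has_derivative_eq_rhs, (rule has_derivative_add has_derivative_scaleR_left has_derivative_mult E H angle_deriv)+)
       (use m in \<open>auto simp: fun_eq_iff vec_eq_iff forall_3 axis_def meridian_def parallel_def field_simps\<close>)
qed

lemma frechet_derivative_F:
  "frechet_derivative F (at x) = (\<lambda>h. (h$1 * speed (x$1)) *\<^sub>R meridian x + h$2 *\<^sub>R parallel x)"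
  by (rule frechet_derivative_at[OF F_has_derivative, symmetric])

lemma inner_frame:
  "meridian x \<bullet> meridian x = (slope (x$1))\<^sup>2 + m\<^sup>2"
  "parallel x \<bullet> parallel x = (exp (x$1 ^ n))\<^sup>2"
  "meridian x \<bullet> parallel x = 0" "parallel x \<bullet> meridian x = 0"
proof -
  show "meridian x \<bullet> meridian x = (slope (x$1))\<^sup>2 + m\<^sup>2"
    using sin_cos_squared_add[of "x$2 / m"] unfolding meridian_def inner_vector_3 by algebra
  show "parallel x \<bullet> parallel x = (exp (x$1 ^ n))\<^sup>2"
    using sin_cos_squared_add[of "x$2 / m"] unfolding parallel_def inner_vector_3 by algebra
qed (simp_all add: meridian_def parallel_def inner_vector_3)

lemma slope_m_pos: "(slope u)\<^sup>2 + m\<^sup>2 > 0"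
  using m by (simp add: add_nonneg_pos)

lemma speed_eq_0_iff: "speed u = 0 \<longleftrightarrow> u = 0"
  using n by (simp add: speed_def)

lemma singular_set_F: "singular_set plane F = {x. x$1 = 0}"
proof -
  have "inj (frechet_derivative F (at x)) \<longleftrightarrow> x$1 \<noteq> 0" for x
  proof
    assume inj: "inj (frechet_derivative F (at x))"
    show "x$1 \<noteq> 0"
    proof
      assume "x$1 = 0"
      then have "frechet_derivative F (at x) e_u = frechet_derivative F (at x) 0"
        by (simp add: frechet_derivative_F speed_eq_0_iff axis_def)
      with inj have "e_u = 0" by (rule injD)
      then show False by (simp add: axis_eq_0_iff)
    qed
  next
    assume x: "x$1 \<noteq> 0"
    have lin: "linear (frechet_derivative F (at x))"
      using F_has_derivative has_derivative_linear frechet_derivative_F by metis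
    show "inj (frechet_derivative F (at x))"
      unfolding linear_injective_0[OF lin]
    proof (intro allI impI)
      fix h assume "frechet_derivative F (at x) h = 0"
      then have h: "(h$1 * speed (x$1)) *\<^sub>R meridian x + h$2 *\<^sub>R parallel x = 0"
        by (simp add: frechet_derivative_F)
      have "h$1 * speed (x$1) * ((slope (x$1))\<^sup>2 + m\<^sup>2) = 0"
        using arg_cong[OF h, of "\<lambda>w. w \<bullet> meridian x"] by (simp add: inner_add_left inner_frame)
      moreover have "h$2 * (exp (x$1 ^ n))\<^sup>2 = 0"
        using arg_cong[OF h, of "\<lambda>w. w \<bullet> parallel x"] by (simp add: inner_add_left inner_frame)
      ultimately show "h = 0"
        using x m by (simp add: speed_eq_0_iff vec_eq_iff forall_2)
    qed
  qed
  then show ?thesis by (auto simp: singular_set_plane)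
qed

text \<open>The dependence on the surface through \<open>m\<^sup>2 + slope\<^sup>2\<close> alone is the source of all isometries used here.\<close>

lemma first_fundamental_form_F:
  "first_fundamental_form (UNIV, id) F x X Y =
     X$1 * Y$1 * (speed (x$1))\<^sup>2 * ((slope (x$1))\<^sup>2 + m\<^sup>2) + X$2 * Y$2 * (exp (x$1 ^ n))\<^sup>2"
  by (simp add: first_fundamental_form_def frechet_derivative_F inner_add_left inner_add_right
      inner_frame power2_eq_square algebra_simps)

lemma surface_F: "surface plane F"
proof -
  have "closure {x::real^2. x$1 \<noteq> 0} = UNIV"
  proof -
    have "interior {x::real^2. e_u \<bullet> x = 0} = {}"
      by (rule interior_hyperplane) (simp add: axis_eq_0_iff)
    then have "interior {x::real^2. x$1 = 0} = {}"
      by (simp add: inner_axis' )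
    then show ?thesis
      by (simp add: closure_interior Collect_neg_eq[symmetric])
  qed
  moreover have "UNIV - {x::real^2. x$1 = 0} = {x. x$1 \<noteq> 0}" by auto
  ultimately show ?thesis
    by (simp add: surface_def oriented_2_manifold_plane smooth_F singular_set_F)
qed

lemma unit_normal_F: "unit_normal_on plane F UNIV normal"
proof -
  have "smooth_on UNIV normal"
    unfolding normal_def[abs_def]
    by (intro smooth_on_intros smooth_on_sqrt smooth_slope_comp open_UNIV)
       (use m slope_m_pos in \<open>auto simp: real_sqrt_eq_zero_cancel_iff less_imp_neq[THEN not_sym]\<close>)
  moreover have "norm (normal x) = 1" for x
  proof -
    have "vector [slope (x$1) * cos (x$2 / m), slope (x$1) * sin (x$2 / m), - m] \<bullet>
        (vector [slope (x$1) * cos (x$2 / m), slope (x$1) * sin (x$2 / m), - m] :: real^3) = (slope (x$1))\<^sup>2 + m\<^sup>2"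
      using sin_cos_squared_add[of "x$2 / m"] unfolding inner_vector_3 by algebra
    then show ?thesis
      using m by (simp add: normal_def norm_eq_sqrt_inner)
  qed
  moreover have "meridian x \<bullet> normal x = 0" "parallel x \<bullet> normal x = 0" for x
  proof -
    show "meridian x \<bullet> normal x = 0"
      using sin_cos_squared_add[of "x$2 / m"]
      unfolding normal_def meridian_def inner_scaleR_right inner_vector_3
      by algebra
    show "parallel x \<bullet> normal x = 0"
      by (simp add: normal_def parallel_def inner_vector_3)
  qed
  ultimately show ?thesis
    by (simp add: unit_normal_on_def frechet_derivative_F inner_add_left)
qed

lemma frontal_F: "frontal plane F"
  unfolding frontal_def using surface_F unit_normal_F by (auto intro!: exI[of _ UNIV])

lemma invariant_F: "invariant_under plane F rotation"
  unfolding invariant_under_def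
proof
  fix t
  have "F (x + (m * t) *\<^sub>R e_v) = rotation t (F x)" for x
  proof -
    have "(x$2 + m * t) / m = x$2 / m + t" using m by (simp add: field_simps)
    then show ?thesis
      by (simp add: edge_def rotation_def vec_eq_iff forall_3 cos_add sin_add axis_def algebra_simps)
  qed
  then show "\<exists>\<phi>. diffeo_of plane (points plane) \<phi> \<and> (\<forall>q\<in>points plane. F (\<phi> q) = rotation t (F q))"
    using diffeo_of_plane_translation[of "(m * t) *\<^sub>R e_v"] by auto
qed

lemma slope_0: "slope 0 = \<rho>"
  using i by (simp add: slope_def)

text \<open>The acceleration of the singular parallel points to the axis, while the limiting unit normal
  has a horizontal component proportional to \<open>slope 0 = \<rho>\<close>.\<close>

lemma generic_F:
  assumes "x$1 = 0"
  shows "generic_at plane F x"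
proof -
  have par: "parallel x \<noteq> 0" using inner_frame(2)[of x] by auto
  have D: "frechet_derivative F (at x) = (\<lambda>h. h$2 *\<^sub>R parallel x)"
    using assms speed_eq_0_iff[of 0] by (simp add: frechet_derivative_F)
  have "range (frechet_derivative F (at x)) = span {parallel x}"
  proof -
    have "t *\<^sub>R parallel x \<in> range (\<lambda>h::real^2. h$2 *\<^sub>R parallel x)" for t
      by (rule image_eqI[of _ _ "t *\<^sub>R e_v"]) (auto simp: axis_def)
    then show ?thesis unfolding D span_singleton by auto
  qed
  then have rank: "rank_one_at plane F x"
    using par by (simp add: rank_one_at_def dim_span)
  have ev: "dir_deriv (\<lambda>_. e_v) F = parallel"
    by (rule ext) (simp add: dir_deriv_def frechet_derivative_F axis_def)
  have "(parallel has_derivative (\<lambda>h. (h$1 * speed (x$1)) *\<^sub>R parallel x +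
      (h$2 * (- exp (x$1 ^ n) / m)) *\<^sub>R vector [cos (x$2 / m), sin (x$2 / m), 0])) (at x)"
  proof -
    show ?thesis
      unfolding parallel_def[abs_def] vector_3_expand
      by (rule has_derivative_eq_rhs, (rule has_derivative_add has_derivative_scaleR_left has_derivative_mult
            has_derivative_minus has_derivative_const exp_power_deriv angle_deriv)+)
         (use assms in \<open>auto simp: fun_eq_iff vec_eq_iff forall_3 axis_def speed_def field_simps\<close>)
  qed
  from dir_deriv_eqI[OF this, of "\<lambda>_. e_v"]
  have dvv: "dir_deriv (\<lambda>_. e_v) parallel x = (- exp (x$1 ^ n) / m) *\<^sub>R vector [cos (x$2 / m), sin (x$2 / m), 0]"
    by (simp add: axis_def)
  have "dir_deriv (\<lambda>_. e_v) parallel x \<bullet> normal x =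
      (- exp (x$1 ^ n) / m) * ((1 / sqrt ((slope (x$1))\<^sup>2 + m\<^sup>2)) * slope (x$1))"
    using sin_cos_squared_add[of "x$2 / m"]
    unfolding dvv normal_def inner_scaleR_right inner_scaleR_left inner_vector_3 by algebra
  also have "\<dots> \<noteq> 0"
    using assms \<rho> m slope_0 slope_m_pos[of 0] by simp
  finally have "limiting_normal_curvature (UNIV, id) F normal x \<noteq> 0"
    using par by (simp add: limiting_normal_curvature_def Let_def ev)
  moreover have "diff_at (UNIV, id) F x e_u = 0"
    by (simp add: D axis_def)
  ultimately show ?thesis
    unfolding generic_at_def using rank standard_chart_oriented[of x] unit_normal_F
    by (metis UNIV_I plane_simps(1) open_UNIV open_openin)
qed

text \<open>Cylindrical coordinates around the singular parallel, with the logarithm of the radius as first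
  coordinate, the angle counted from \<open>v0 / m\<close>, and the height corrected by the multiple of the radius that
  leaves only the term \<open>u^(n+i) a(u)\<close>. Their inverse is \<open>roll\<close>.\<close>
definition unroll :: "real \<Rightarrow> real^3 \<Rightarrow> real^3" where
  "unroll v0 y = (let X = cos (v0 / m) * y$1 + sin (v0 / m) * y$2; Y = cos (v0 / m) * y$2 - sin (v0 / m) * y$1
     in vector [ln (sqrt (X\<^sup>2 + Y\<^sup>2) / m), y$3 - \<rho> / m * sqrt (X\<^sup>2 + Y\<^sup>2), m * arctan (Y / X)])"

definition roll :: "real \<Rightarrow> real^3 \<Rightarrow> real^3" where
  "roll v0 w = vector [m * exp (w$1) * cos ((w$3 + v0) / m), m * exp (w$1) * sin ((w$3 + v0) / m),
     w$2 + \<rho> * exp (w$1)]"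

lemma F_eq_roll: "F x = roll v0 (vector [x$1 ^ n, x$1 ^ (n + i) * a (x$1), x$2 - v0])"
  by (simp add: edge_def roll_def add.commute)

lemma roll_rotated:
  "cos (v0 / m) * roll v0 w $ 1 + sin (v0 / m) * roll v0 w $ 2 = m * exp (w$1) * cos (w$3 / m)"
  "cos (v0 / m) * roll v0 w $ 2 - sin (v0 / m) * roll v0 w $ 1 = m * exp (w$1) * sin (w$3 / m)"
proof -
  have s: "(w$3 + v0) / m = w$3 / m + v0 / m" by (simp add: add_divide_distrib)
  show "cos (v0 / m) * roll v0 w $ 1 + sin (v0 / m) * roll v0 w $ 2 = m * exp (w$1) * cos (w$3 / m)"
    using sin_cos_squared_add[of "v0 / m"]
    unfolding roll_def vector_3 s sin_add cos_add by algebra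
  show "cos (v0 / m) * roll v0 w $ 2 - sin (v0 / m) * roll v0 w $ 1 = m * exp (w$1) * sin (w$3 / m)"
    using sin_cos_squared_add[of "v0 / m"]
    unfolding roll_def vector_3 s sin_add cos_add by algebra
qed

lemma unroll_roll:
  assumes "\<bar>w$3\<bar> < m * (pi / 2)"
  shows "unroll v0 (roll v0 w) = w"
proof -
  have "- (pi/2) < w$3 / m" "w$3 / m < pi/2" using assms m by (auto simp: field_simps)
  then have t: "arctan (tan (w$3 / m)) = w$3 / m" and c: "cos (w$3 / m) > 0"
    by (auto intro: arctan_tan cos_gt_zero_pi)
  have r: "sqrt ((m * exp (w$1) * cos (w$3 / m))\<^sup>2 + (m * exp (w$1) * sin (w$3 / m))\<^sup>2) = m * exp (w$1)"
  proof -
    have "(m * exp (w$1) * cos (w$3 / m))\<^sup>2 + (m * exp (w$1) * sin (w$3 / m))\<^sup>2 = (m * exp (w$1))\<^sup>2"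
      using sin_cos_squared_add[of "w$3 / m"] by algebra
    then show ?thesis using m by simp
  qed
  have q: "m * exp (w$1) * sin (w$3 / m) / (m * exp (w$1) * cos (w$3 / m)) = tan (w$3 / m)"
    using m by (simp add: tan_def)
  show ?thesis
    unfolding unroll_def Let_def roll_rotated r q t
    using m by (simp add: vec_eq_iff forall_3 roll_def)
qed

lemma roll_unroll:
  assumes "cos (v0 / m) * y$1 + sin (v0 / m) * y$2 > 0"
  shows "roll v0 (unroll v0 y) = y" "\<bar>unroll v0 y $ 3\<bar> < m * (pi / 2)"
proof -
  define X Y where "X = cos (v0 / m) * y$1 + sin (v0 / m) * y$2" and "Y = cos (v0 / m) * y$2 - sin (v0 / m) * y$1"
  define r where "r = sqrt (X\<^sup>2 + Y\<^sup>2)"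
  have X: "X > 0" using assms by (simp add: X_def)
  then have r: "r > 0" by (simp add: r_def add_pos_nonneg)
  have u: "unroll v0 y = vector [ln (r / m), y$3 - \<rho> / m * r, m * arctan (Y / X)]"
    by (simp add: unroll_def Let_def X_def Y_def r_def)
  have e: "exp (ln (r / m)) = r / m" using r m by simp
  have rX: "sqrt (1 + (Y / X)\<^sup>2) = r / X"
  proof -
    have "1 + (Y / X)\<^sup>2 = (X\<^sup>2 + Y\<^sup>2) / X\<^sup>2" using X by (simp add: field_simps)
    then show ?thesis using X by (simp add: r_def real_sqrt_divide)
  qed
  have c: "r * cos (arctan (Y / X)) = X" and s: "r * sin (arctan (Y / X)) = Y"
    unfolding cos_arctan sin_arctan rX using r X by (simp_all add: field_simps)
  have arg: "(m * arctan (Y / X) + v0) / m = arctan (Y / X) + v0 / m"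
    using m by (simp add: field_simps)
  have "r * cos (arctan (Y / X) + v0 / m) =
      cos (v0 / m) * (r * cos (arctan (Y / X))) - sin (v0 / m) * (r * sin (arctan (Y / X)))"
    by (simp only: cos_add right_diff_distrib mult_ac)
  also have "\<dots> = cos (v0 / m) * X - sin (v0 / m) * Y" by (simp only: c s)
  also have "\<dots> = y$1"
    using sin_cos_squared_add[of "v0 / m"] unfolding X_def Y_def by algebra
  finally have 1: "r * cos (arctan (Y / X) + v0 / m) = y$1" .
  have "r * sin (arctan (Y / X) + v0 / m) =
      sin (v0 / m) * (r * cos (arctan (Y / X))) + cos (v0 / m) * (r * sin (arctan (Y / X)))"
    by (simp only: sin_add distrib_left mult_ac add_ac)
  also have "\<dots> = sin (v0 / m) * X + cos (v0 / m) * Y" by (simp only: c s)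
  also have "\<dots> = y$2"
    using sin_cos_squared_add[of "v0 / m"] unfolding X_def Y_def by algebra
  finally have 2: "r * sin (arctan (Y / X) + v0 / m) = y$2" .
  show "roll v0 (unroll v0 y) = y"
    unfolding u roll_def vector_3 e arg vec_eq_iff forall_3
    using 1 2 m by simp
  show "\<bar>unroll v0 y $ 3\<bar> < m * (pi / 2)"
  proof -
    have "\<bar>arctan (Y / X)\<bar> < pi / 2"
      using arctan_bounded[of "Y / X"] unfolding abs_less_iff by linarith
    then show ?thesis using m unfolding u by (simp add: abs_mult)
  qed
qed

lemma n_type_edge_F:
  assumes "p$1 = 0"
  shows "n_type_edge_at n plane F p"
proof -
  define v0 where "v0 = p$2"
  define U where "U = {y::real^3. cos (v0 / m) * y$1 + sin (v0 / m) * y$2 > 0}"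
  define V where "V = {w::real^3. \<bar>w$3\<bar> < m * (pi / 2)}"
  have Fp: "F p = roll v0 0"
    unfolding F_eq_roll[of p v0] using assms n by (simp add: v0_def roll_def power_0_left)
  have openU: "open U" unfolding U_def by (intro open_Collect_less continuous_intros)
  have openV: "open V" unfolding V_def by (intro open_Collect_less continuous_intros)
  have zero: "(0::real^3) \<in> V" using m by (simp add: V_def)
  have rollU: "roll v0 w \<in> U" if "w \<in> V" for w
  proof -
    have "- (pi/2) < w$3 / m" "w$3 / m < pi/2" using that m by (auto simp: V_def field_simps)
    then show ?thesis using m by (simp add: U_def roll_rotated cos_gt_zero_pi)
  qed
  have pos: "(cos (v0 / m) * y$1 + sin (v0 / m) * y$2)\<^sup>2 + (cos (v0 / m) * y$2 - sin (v0 / m) * y$1)\<^sup>2 > 0"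
    if "y \<in> U" for y using that by (simp add: U_def add_pos_nonneg)
  have target: "diffeo_germ (unroll v0) (F p) 0"
  proof (rule diffeo_germI[OF openU openV, where \<Theta> = "roll v0"])
    show "F p \<in> U" unfolding Fp by (rule rollU[OF zero])
    show "unroll v0 (F p) = 0" unfolding Fp by (rule unroll_roll) (use m in simp)
    show "smooth_on U (unroll v0)"
      unfolding unroll_def[abs_def] Let_def
      by (intro smooth_on_intros smooth_on_compose[OF smooth_on_ln_real] smooth_on_sqrt
          smooth_on_compose_UNIV[OF smooth_on_arctan] openU)
         (use m pos in \<open>auto simp: U_def\<close>)
    show "smooth_on V (roll v0)"
      unfolding roll_def[abs_def] by (intro smooth_on_intros openV) (use m in auto)
  qed (use roll_unroll unroll_roll rollU in \<open>auto simp: U_def V_def\<close>)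
  have source: "diffeo_germ (\<lambda>x. x - p) p 0"
    by (rule diffeo_germI[of UNIV UNIV _ _ _ "\<lambda>x. x + p"])
       (auto intro: smooth_on_add smooth_on_diff)
  have "open {x::real^2. \<bar>x$2 - v0\<bar> < m * (pi / 2)}"
    by (intro open_Collect_less continuous_intros)
  moreover have "p \<in> {x. \<bar>x$2 - v0\<bar> < m * (pi / 2)}" using m by (simp add: v0_def)
  ultimately have "\<forall>\<^sub>F x in nhds p. x \<in> {x. \<bar>x$2 - v0\<bar> < m * (pi / 2)}"
    by (rule eventually_nhds_in_open)
  then have ev: "\<forall>\<^sub>F x in nhds p. unroll v0 (F x) = n_type_edge_model n (\<lambda>x. x$1 ^ (i - 1) * a (x$1)) (x - p)"
  proof (rule eventually_mono)
    fix x :: "real^2" assume "x \<in> {x. \<bar>x$2 - v0\<bar> < m * (pi / 2)}"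
    then have "unroll v0 (F x) = vector [x$1 ^ n, x$1 ^ (n + i) * a (x$1), x$2 - v0]"
      unfolding F_eq_roll[of x v0] by (intro unroll_roll) simp
    moreover have "x$1 ^ (n + i) = x$1 ^ (n + 1) * x$1 ^ (i - 1)"
      using i by (simp flip: power_add power_Suc)
    ultimately show "unroll v0 (F x) = n_type_edge_model n (\<lambda>x. x$1 ^ (i - 1) * a (x$1)) (x - p)"
      using assms by (simp add: n_type_edge_model_def v0_def mult.assoc)
  qed
  have "smooth_on UNIV (\<lambda>x::real^2. x$1 ^ (i - 1) * a (x$1))"
    by (intro smooth_on_intros smooth_on_compose_UNIV[OF a] open_UNIV)
  then show ?thesis
    unfolding n_type_edge_at_def using target source ev
    by (simp, intro exI[of _ "\<lambda>x. x$1 ^ (i - 1) * a (x$1)"] exI[of _ "\<lambda>x. x - p"] exI[of _ "unroll v0"]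
        exI[of _ UNIV]) simp
qed

lemma generic_helicoidal_edge_F: "generic_helicoidal_edge n plane F"
proof -
  have nonempty: "{x::real^2. x$1 = 0} \<noteq> {}"
    using zero_index by blast
  show ?thesis
    unfolding generic_helicoidal_edge_def singular_set_F
  proof (intro conjI ballI exI[of _ rotation])
    show "n > 1" using n by simp
  qed (use nonempty in \<open>simp_all add: frontal_F helicoidal_motion_rotation invariant_F n_type_edge_F generic_F\<close>)
qed

end

section \<open>The invariants of a surface of revolution\<close>

lemma tangent_to_line:
  assumes "tangent_to {x::real^2. x$1 = 0} x w"
  shows "w$1 = 0"
proof -
  obtain \<gamma> where \<gamma>: "(\<gamma> has_vector_derivative w) (at 0)"
    and ev: "\<forall>\<^sub>F t in nhds (0::real). \<gamma> t \<in> {x. x$1 = 0}"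
    using assms unfolding tangent_to_def by blast
  obtain T where T: "open T" "0 \<in> T" "\<And>t. t \<in> T \<Longrightarrow> \<gamma> t $ 1 = 0"
    using ev unfolding eventually_nhds by auto
  have "((\<lambda>t. \<gamma> t $ 1) has_vector_derivative w$1) (at 0)"
    by (rule bounded_linear.has_vector_derivative[OF bounded_linear_vec_nth \<gamma>])
  then have "((\<lambda>t. 0) has_vector_derivative w$1) (at (0::real))"
    by (rule has_vector_derivative_transform_within_open[OF _ T(1,2)]) (rule T(3))
  then show ?thesis
    using vector_derivative_unique_at[OF _ has_vector_derivative_const] by blast
qed

text \<open>A determinant with a first row tangent to a horizontal circle is computed in the plane
  spanned by the radial direction \<open>(c, s, 0)\<close> and the axis.\<close>

lemma det_vector_horizontal:
  "det (vector [vector [- s * k, c * k, 0], b, d] :: real^3^3) =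
     - k * ((vector [c, s, 0] \<bullet> b) * d$3 - b$3 * (vector [c, s, 0] \<bullet> d))"
  by (simp add: det_3 inner_vec_def sum_3 algebra_simps)

context revolution_edge begin

text \<open>The absolute value of the first cuspidal curvature, or bias, that does not have to vanish.\<close>
definition omega_value :: real where
  "omega_value = m * \<bar>a 0\<bar> * fact n * fact (n + i) /
     (fact n * sqrt (m\<^sup>2 + \<rho>\<^sup>2)) powr (real (2 * n + i) / real n)"

text \<open>The exponents in the definition of the invariants make the length \<open>k\<close> of \<open>\<xi>\<close> and the transversal
  component \<open>\<alpha>\<close> of \<open>\<eta>\<close> cancel.\<close>

lemma omega_ratio:
  fixes k \<alpha> :: real
  assumes "k \<noteq> 0" "\<alpha> \<noteq> 0"
  shows "\<bar>k\<bar> powr (real (n + i) / real n) * (\<bar>k\<bar> * (m * fact n * \<bar>\<alpha>\<bar> ^ n) * (fact (n + i) * \<bar>\<alpha>\<bar> ^ (n + i) * \<bar>a 0\<bar>)) /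
     (\<bar>k\<bar> * (fact n * \<bar>\<alpha>\<bar> ^ n * sqrt (m\<^sup>2 + \<rho>\<^sup>2))) powr (real (2 * n + i) / real n) = omega_value"
proof -
  define q where "q = real (2 * n + i) / real n"
  have n0: "real n > 0" using n by simp
  have "(\<bar>\<alpha>\<bar> ^ n) powr q = \<bar>\<alpha>\<bar> powr (real n * q)"
    using assms by (simp add: powr_powr flip: powr_realpow)
  also have "real n * q = real (2 * n + i)" using n0 by (simp add: q_def)
  also have "\<bar>\<alpha>\<bar> powr real (2 * n + i) = \<bar>\<alpha>\<bar> ^ (2 * n + i)"
    using assms by (subst powr_realpow) auto
  finally have 1: "(\<bar>\<alpha>\<bar> ^ n) powr q = \<bar>\<alpha>\<bar> ^ n * \<bar>\<alpha>\<bar> ^ (n + i)"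
    by (simp add: power_add mult_2)
  have "q = real (n + i) / real n + 1" using n0 by (simp add: q_def field_simps)
  then have 2: "\<bar>k\<bar> powr q = \<bar>k\<bar> powr (real (n + i) / real n) * \<bar>k\<bar>"
    using assms by (simp add: powr_add)
  have "(\<bar>k\<bar> * (fact n * \<bar>\<alpha>\<bar> ^ n * sqrt (m\<^sup>2 + \<rho>\<^sup>2))) powr q =
      \<bar>k\<bar> powr q * ((\<bar>\<alpha>\<bar> ^ n) powr q * (fact n * sqrt (m\<^sup>2 + \<rho>\<^sup>2)) powr q)"
    by (simp add: powr_mult mult_ac)
  then show ?thesis
    unfolding q_def[symmetric] omega_value_def 1 2
    using assms by (simp add: mult_ac)
qed

text \<open>The conditions on \<open>\<eta>\<close> say that the integral curve of \<open>\<eta>\<close> is mapped by \<open>F\<close> to a curve whose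
  derivatives up to order \<open>n - 1\<close> vanish. In the frame \<open>er\<close>, \<open>et\<close>, \<open>e\<^sub>3\<close> at the singular point the component
  \<open>Y\<close> along the parallel therefore vanishes to order \<open>n\<close>, and even to order \<open>n + 1\<close> under the normalization
  used for the bias. The radial component \<open>A\<close> differs from the radius \<open>R\<close> by \<open>Y\<^sup>2 / (R + A)\<close>, so up to
  the order needed it can be replaced by \<open>R\<close>. The height is \<open>\<rho>/m R\<close> plus a function of order \<open>n + i\<close>, and
  the multiple of \<open>R\<close> drops out of the determinant. Only leading Taylor coefficients along \<open>\<eta>\<close> remain.\<close>

lemma adapted_pair_omega:
  assumes p: "p$1 = 0" and pair: "adapted_pair n plane F p c \<xi> \<eta>" and j: "j \<le> i" "j \<le> n"
    and normalized: "j < n \<or>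
      dir_deriv \<xi> (local_rep c F) (snd c p) \<bullet> (dir_deriv \<eta> ^^ n) (local_rep c F) (snd c p) = 0"
  shows "\<bar>omega_expr n j (local_rep c F) \<xi> \<eta> (snd c p)\<bar> = (if j < i then 0 else omega_value)"
proof -
  have c: "c = (UNIV, id)" using pair by (simp add: adapted_pair_def Let_def)
  obtain N where N: "open N" "p \<in> N" "smooth_on N \<xi>" "smooth_on N \<eta>" "\<eta> p \<noteq> 0" "\<xi> p \<noteq> 0"
    and tangent: "tangent_to {x. x$1 = 0} p (\<xi> p)" and D1: "dir_deriv \<eta> F p = 0"
    and D2: "\<And>k. k \<in> {2..n-1} \<Longrightarrow> (dir_deriv \<eta> ^^ k) F p = 0"
    using pair p unfolding adapted_pair_def Let_def c by (auto simp: singular_set_F)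
  let ?D = "dir_deriv \<eta>"
  define v0 where "v0 = p$2"
  define er et where "er = (vector [cos (v0 / m), sin (v0 / m), 0] :: real^3)"
    and "et = (vector [- sin (v0 / m), cos (v0 / m), 0] :: real^3)"
  have par: "parallel p = et"
    using p n by (simp add: parallel_def et_def v0_def power_0_left)
  have et1: "et \<bullet> et = 1"
    using sin_cos_squared_add[of "v0 / m"] unfolding et_def inner_vector_3 by algebra
  have speed0: "speed 0 = 0" by (simp add: speed_eq_0_iff)
  have dF: "dir_deriv \<zeta> F p = (\<zeta> p $ 2) *\<^sub>R et" for \<zeta>
    by (simp add: dir_deriv_def frechet_derivative_F p speed0 par)
  define \<kappa> where "\<kappa> = \<xi> p $ 2"
  define \<alpha> where "\<alpha> = \<eta> p $ 1"
  have \<kappa>: "\<kappa> \<noteq> 0"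
    using tangent_to_line[OF tangent] N(6) by (auto simp: \<kappa>_def vec_eq_iff forall_2)
  have et0: "et \<noteq> 0" using et1 by auto
  have "\<eta> p $ 2 = 0" using D1 et0 by (simp add: dF)
  then have \<alpha>: "\<alpha> \<noteq> 0" using N(5) by (auto simp: \<alpha>_def vec_eq_iff forall_2)

  define A Y R u :: "real^2 \<Rightarrow> real" where "A = (\<lambda>x. F x \<bullet> er)" and "Y = (\<lambda>x. F x \<bullet> et)"
    and "R = (\<lambda>x. m * exp (x$1 ^ n))" and "u = (\<lambda>x. x$1)"
  have F: "smooth_on N F" using smooth_on_subset[OF smooth_F] by simp
  have A: "smooth_on N A" and Y: "smooth_on N Y" and R: "smooth_on N R" and u: "smooth_on N u"
    unfolding A_def Y_def R_def u_def by (intro smooth_on_intros F N)+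
  have Acos: "A x = R x * cos ((x$2 - v0) / m)" and Ysin: "Y x = R x * sin ((x$2 - v0) / m)" for x
    unfolding A_def Y_def R_def er_def et_def edge_def inner_vector_3 diff_divide_distrib cos_diff sin_diff
    by (simp_all add: algebra_simps)
  have DA: "(?D ^^ k) A p = (?D ^^ k) F p \<bullet> er" and DY: "(?D ^^ k) Y p = (?D ^^ k) F p \<bullet> et" for k
    unfolding A_def Y_def
    by (rule funpow_dir_deriv_linear[OF N(1,4) F bounded_linear_inner_left N(2)])+

  \<comment> \<open>Twice this order exceeds \<open>n + j\<close>; for \<open>j = n\<close> that takes the normalization.\<close>
  define l where "l = (if j < n then n else Suc n)"
  have Yl: "vanishes_to_order \<eta> p l Y"
    unfolding vanishes_to_order_def
  proof (intro allI impI)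
    fix k assume k: "k < l"
    consider "k = 0" | "k = 1" | "k \<in> {2..n-1}" | "k = n" "\<not> j < n"
      using k by (fastforce simp: l_def split: if_splits)
    then show "(?D ^^ k) Y p = 0"
    proof cases
      case 4
      then have "\<kappa> * (et \<bullet> (?D ^^ n) F p) = 0"
        using normalized by (simp add: c dF \<kappa>_def)
      then show ?thesis using 4 \<kappa> by (simp add: DY inner_commute)
    next
      case 2
      then show ?thesis using DY[of 1] D1 by simp
    next
      case 3
      then show ?thesis by (simp add: DY D2)
    qed (simp add: Ysin v0_def)
  qed
  \<comment> \<open>Away from \<open>p\<close> the denominator \<open>R + A\<close> might vanish.\<close>
  define N' where "N' = N \<inter> {x. cos ((x$2 - v0) / m) > 0}"
  have N': "open N'" "p \<in> N'" "N' \<subseteq> N"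
    unfolding N'_def
    by (intro open_Int N open_Collect_less continuous_intros) (use m N in \<open>auto simp: v0_def\<close>)
  have sm: "smooth_on N' h" if "smooth_on N h" for h :: "real^2 \<Rightarrow> 'c::euclidean_space"
    by (rule smooth_on_subset[OF that N'(3)])
  have pos: "R x + A x > 0" if "x \<in> N'" for x
    using that m by (simp add: N'_def Acos R_def add_pos_pos)
  define Q where "Q = (\<lambda>x. Y x *\<^sub>R (Y x *\<^sub>R inverse (R x + A x)))"
  have inv: "smooth_on N' (\<lambda>x. inverse (R x + A x))"
    by (intro smooth_on_inverse smooth_on_add sm R A N') (use pos in force)
  have Q: "smooth_on N' Q"
    unfolding Q_def by (intro smooth_on_scaleR inv sm Y N')
  have "vanishes_to_order \<eta> p (2 * l) Q"
  proof -
    have YI: "smooth_on N' (\<lambda>x. Y x *\<^sub>R inverse (R x + A x))"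
      by (intro smooth_on_scaleR N' sm[OF Y] inv)
    have "vanishes_to_order \<eta> p l (\<lambda>x. Y x *\<^sub>R inverse (R x + A x))"
      by (rule vanishes_to_order_scaleR[OF N'(1,2) sm[OF N(4)] sm[OF Y] inv Yl vanishes_to_order_0]) simp
    then show ?thesis
      unfolding Q_def
      by (rule vanishes_to_order_scaleR[OF N'(1,2) sm[OF N(4)] sm[OF Y] YI Yl]) simp
  qed
  moreover have "R x = A x + Q x" if "x \<in> N'" for x
  proof -
    have "(R x)\<^sup>2 = (A x)\<^sup>2 + (Y x)\<^sup>2"
      using sin_cos_squared_add[of "(x$2 - v0) / m"] unfolding Acos Ysin by algebra
    then have "(R x - A x) * (R x + A x) = Y x * Y x" by algebra
    then show ?thesis using pos[OF that] by (simp add: Q_def field_simps)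
  qed
  ultimately have RA: "(?D ^^ k) R p = (?D ^^ k) A p" if "k < 2 * l" for k
    using funpow_dir_deriv_cong[OF N'(1) _ N'(2), of R "\<lambda>x. A x + Q x"]
      funpow_dir_deriv_add[OF N'(1) sm[OF N(4)] sm[OF A] Q N'(2)] that
    by (simp add: vanishes_to_order_def)

  have du: "dir_deriv \<eta> u p = \<alpha>"
    unfolding u_def \<alpha>_def by (rule dir_deriv_eqI[OF vec_nth_deriv])
  have u0: "u p = 0" using p by (simp add: u_def)
  have Rn: "(?D ^^ n) R p = m * fact n * \<alpha> ^ n"
  proof -
    define g where "g = (\<lambda>x. m * real n * exp (x$1 ^ n) * \<eta> x $ 1)"
    have g: "smooth_on N g"
      unfolding g_def by (intro smooth_on_intros N)
    obtain k where k: "n = Suc k" using n by (cases n) auto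
    have "?D R = (\<lambda>x. u x ^ k *\<^sub>R g x)"
    proof
      fix x :: "real^2"
      have "((\<lambda>u. m * exp (u ^ n)) has_real_derivative m * (exp (x$1 ^ n) * (real n * x$1 ^ k))) (at (x$1))"
        by (rule derivative_eq_intros refl | simp add: k)+
      from dir_deriv_eqI[OF has_derivative_compose[OF vec_nth_deriv this[unfolded has_field_derivative_def]]]
      show "?D R x = u x ^ k *\<^sub>R g x" by (simp add: R_def g_def u_def mult_ac)
    qed
    then have "(?D ^^ n) R p = (?D ^^ k) (\<lambda>x. u x ^ k *\<^sub>R g x) p"
      by (simp add: k funpow_swap1)
    also have "\<dots> = fact k * \<alpha> ^ k * g p"
      using funpow_dir_deriv_power_scaleR[OF N(1,2,4) u u0 g, of k] by (simp add: du)
    also have "g p = m * real n * \<alpha>"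
      using n p by (simp add: g_def \<alpha>_def power_0_left)
    finally show ?thesis by (simp add: k algebra_simps)
  qed

  define e where "e = (\<lambda>x. u x ^ (n + i) *\<^sub>R a (u x))"
  have au: "smooth_on N (\<lambda>x. a (u x))" by (rule smooth_on_compose_UNIV[OF a N(1) u])
  have esm: "smooth_on N e" unfolding e_def by (intro smooth_on_scaleR smooth_on_power N u au)
  have Z: "(?D ^^ k) F p $ 3 = \<rho> / m * (?D ^^ k) R p + (?D ^^ k) e p" for k
  proof -
    have "(?D ^^ k) F p $ 3 = (?D ^^ k) (\<lambda>x. F x $ 3) p"
      using funpow_dir_deriv_linear[OF N(1,4) F bounded_linear_vec_nth N(2)] by simp
    also have "(\<lambda>x. F x $ 3) = (\<lambda>x. \<rho> / m * R x + e x)"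
      using m by (simp add: fun_eq_iff edge_def R_def e_def u_def)
    also have "(?D ^^ k) (\<lambda>x. \<rho> / m * R x + e x) p = (?D ^^ k) (\<lambda>x. \<rho> / m * R x) p + (?D ^^ k) e p"
      by (rule funpow_dir_deriv_add[OF N(1,4) _ esm N(2)]) (intro smooth_on_mult smooth_on_const N R)
    also have "(?D ^^ k) (\<lambda>x. \<rho> / m * R x) p = \<rho> / m * (?D ^^ k) R p"
      by (rule funpow_dir_deriv_linear[OF N(1,4) R bounded_linear_mult_right N(2)])
    finally show ?thesis .
  qed
  have e_low: "(?D ^^ k) e p = 0" if "k < n + i" for k
    using vanishes_to_order_power_scaleR[OF N(1,2,4) u u0 au, of "n + i"] that
    by (simp add: e_def vanishes_to_order_def)
  have e_top: "(?D ^^ (n + i)) e p = fact (n + i) * \<alpha> ^ (n + i) * a 0"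
    using funpow_dir_deriv_power_scaleR[OF N(1,2,4) u u0 au, of "n + i"]
    by (simp add: e_def du u0)

  define b d X where "b = (?D ^^ n) F p" and "d = (?D ^^ (n + j)) F p" and "X = m * fact n * \<alpha> ^ n"
  have "n < 2 * l" "n + j < 2 * l" using n j by (auto simp: l_def)
  then have ber: "b \<bullet> er = X" and der: "d \<bullet> er = (?D ^^ (n + j)) R p"
    using RA[of n] RA[of "n + j"] by (simp_all add: b_def d_def DA Rn X_def)
  have b3: "b $ 3 = \<rho> / m * X" using Z[of n] e_low[of n] i by (simp add: b_def Rn X_def)
  have d3: "d $ 3 = \<rho> / m * (?D ^^ (n + j)) R p + (?D ^^ (n + j)) e p" by (simp add: d_def Z)
  have a_vec: "dir_deriv \<xi> F p = \<kappa> *\<^sub>R et" by (simp add: dF \<kappa>_def)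
  have "det (vector [\<kappa> *\<^sub>R et, b, d] :: real^3^3) = - \<kappa> * ((b \<bullet> er) * d$3 - b$3 * (d \<bullet> er))"
  proof -
    have "\<kappa> *\<^sub>R et = vector [- sin (v0 / m) * \<kappa>, cos (v0 / m) * \<kappa>, 0]"
      by (simp add: et_def vec_eq_iff forall_3)
    then show ?thesis by (simp only: det_vector_horizontal er_def inner_commute)
  qed
  then have det: "det (vector [\<kappa> *\<^sub>R et, b, d] :: real^3^3) = - \<kappa> * X * (?D ^^ (n + j)) e p"
    unfolding ber der b3 d3 by (simp add: algebra_simps)
  have norm_a: "norm (\<kappa> *\<^sub>R et) = \<bar>\<kappa>\<bar>" using et1 by (simp add: norm_eq_sqrt_inner)
  have "(norm (cross3 (\<kappa> *\<^sub>R et) b))\<^sup>2 = \<kappa>\<^sup>2 * ((b \<bullet> er)\<^sup>2 + (b $ 3)\<^sup>2)"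
    using sin_cos_squared_add[of "v0 / m"]
    unfolding power2_norm_eq_inner cross3_def er_def et_def inner_vec_def sum_3 inner_real_def vector_3
      vector_scaleR_component real_scaleR_def
    by algebra
  also have "\<dots> = (\<bar>\<kappa>\<bar> * (fact n * \<bar>\<alpha>\<bar> ^ n * sqrt (m\<^sup>2 + \<rho>\<^sup>2)))\<^sup>2"
  proof -
    have "X\<^sup>2 + (\<rho> / m * X)\<^sup>2 = (fact n * \<bar>\<alpha>\<bar> ^ n)\<^sup>2 * (m\<^sup>2 + \<rho>\<^sup>2)"
      using m by (simp add: X_def field_simps power2_eq_square flip: power_mult_distrib)
    then show ?thesis by (simp add: ber b3 power_mult_distrib)
  qed
  finally have norm_ab: "norm (cross3 (\<kappa> *\<^sub>R et) b) = \<bar>\<kappa>\<bar> * (fact n * \<bar>\<alpha>\<bar> ^ n * sqrt (m\<^sup>2 + \<rho>\<^sup>2))"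
    by (simp add: power2_eq_iff_nonneg)
  have omega: "omega_expr n j (local_rep c F) \<xi> \<eta> (snd c p) =
      \<bar>\<kappa>\<bar> powr (real (n + j) / real n) * (- \<kappa> * X * (?D ^^ (n + j)) e p) /
      (\<bar>\<kappa>\<bar> * (fact n * \<bar>\<alpha>\<bar> ^ n * sqrt (m\<^sup>2 + \<rho>\<^sup>2))) powr (real (2 * n + j) / real n)"
    unfolding omega_expr_def Let_def c local_rep_plane snd_conv id_apply a_vec
    unfolding b_def[symmetric] d_def[symmetric] norm_a det norm_ab ..
  show ?thesis
  proof (cases "j < i")
    case True
    then show ?thesis unfolding omega using e_low[of "n + j"] by simp
  next
    case False
    then have "j = i" using j by simp
    then show ?thesis
      unfolding omega using omega_ratio[OF \<kappa> \<alpha>, symmetric] m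
      by (simp add: e_top X_def abs_mult power_abs abs_divide)
  qed
qed

text \<open>Ensures that the choice in the definition of the invariants is made from a non-empty set.\<close>

lemma adapted_pair_coordinates:
  assumes p: "p$1 = 0"
  shows "adapted_pair n plane F p (UNIV, id) (\<lambda>_. e_v) (\<lambda>_. e_u)"
    and "dir_deriv (\<lambda>_. e_v) F p \<bullet> (dir_deriv (\<lambda>_. e_u) ^^ n) F p = 0"
proof -
  define k where "k = n - 1"
  have nk: "n = Suc k" using n by (simp add: k_def)
  define G where "G = (\<lambda>x. (real n * exp (x$1 ^ n)) *\<^sub>R meridian x)"
  have G: "smooth_on UNIV G"
    unfolding G_def meridian_def
    by (intro smooth_on_intros smooth_slope_comp open_UNIV) (use m in auto)
  have u: "smooth_on UNIV (\<lambda>x::real^2. x$1)" by (intro smooth_on_intros open_UNIV)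
  have eu: "smooth_on UNIV (\<lambda>_. e_u)" by simp
  have du: "dir_deriv (\<lambda>_. e_u) (\<lambda>x::real^2. x$1) y = 1" for y
    using dir_deriv_eqI[OF vec_nth_deriv, of "\<lambda>_. e_u" 1 y] by (simp add: axis_def)
  have D1: "dir_deriv (\<lambda>_. e_u) F = (\<lambda>x. (x$1) ^ k *\<^sub>R G x)"
    by (rule ext) (simp add: dir_deriv_def frechet_derivative_F axis_def G_def speed_def k_def mult_ac)
  have D: "(dir_deriv (\<lambda>_. e_u) ^^ Suc j) F = (dir_deriv (\<lambda>_. e_u) ^^ j) (\<lambda>x. (x$1) ^ k *\<^sub>R G x)" for j
    by (simp add: funpow_Suc_right D1 del: funpow.simps)
  have low: "(dir_deriv (\<lambda>_. e_u) ^^ Suc j) F y = 0" if "j < k" "y$1 = 0" for j y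
    using vanishes_to_order_power_scaleR[OF open_UNIV UNIV_I eu u that(2) G, of k] that(1)
    unfolding D vanishes_to_order_def by blast
  have "(dir_deriv (\<lambda>_. e_u) ^^ n) F p = (dir_deriv (\<lambda>_. e_u) ^^ Suc k) F p"
    by (simp only: nk)
  then have top: "(dir_deriv (\<lambda>_. e_u) ^^ n) F p = (fact k * real n) *\<^sub>R meridian p"
    using funpow_dir_deriv_power_scaleR[OF open_UNIV UNIV_I eu u p G, of k] n p
    unfolding D du by (simp add: G_def power_0_left)
  have ev: "dir_deriv (\<lambda>_. e_v) F = parallel"
    by (rule ext) (simp add: dir_deriv_def frechet_derivative_F axis_def)
  have orth: "parallel p \<bullet> (fact k * real n) *\<^sub>R meridian p = 0"
    by (simp add: inner_frame)
  then show "dir_deriv (\<lambda>_. e_v) F p \<bullet> (dir_deriv (\<lambda>_. e_u) ^^ n) F p = 0"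
    by (simp add: ev top)
  have nz: "parallel p \<noteq> 0" "meridian p \<noteq> 0"
    using inner_frame(1,2)[of p] slope_m_pos[of "p$1"] by auto
  then have ne: "parallel p \<noteq> (fact k * real n) *\<^sub>R meridian p"
    using orth by (metis inner_eq_zero_iff)
  have ind: "independent {parallel p, (fact k * real n) *\<^sub>R meridian p}"
    by (rule pairwise_orthogonal_independent)
       (use orth nz n in \<open>auto simp: pairwise_def orthogonal_def inner_commute\<close>)
  have tangent: "tangent_to {x. x$1 = 0} y e_v" if "y$1 = 0" for y
    unfolding tangent_to_def
  proof (intro exI[of _ "\<lambda>t. y + t *\<^sub>R e_v"] conjI)
    show "((\<lambda>t. y + t *\<^sub>R e_v) has_vector_derivative e_v) (at 0)"
      by (auto intro!: derivative_eq_intros)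
  qed (use that in \<open>auto simp: axis_def\<close>)
  have first: "dir_deriv (\<lambda>_. e_u) F y = 0" if "y$1 = 0" for y
    using low[of 0 y] that n by (simp add: k_def)
  have higher: "(dir_deriv (\<lambda>_. e_u) ^^ j) F y = 0" if "y$1 = 0" "j \<in> {2..n-1}" for y j
    using low[of "j - 1" y] that by (cases j) (auto simp: k_def)
  show "adapted_pair n plane F p (UNIV, id) (\<lambda>_. e_v) (\<lambda>_. e_u)"
    unfolding adapted_pair_def Let_def
    using first higher tangent ne ind
    by (auto simp: singular_set_F ev top axis_eq_0_iff intro!: exI[of _ UNIV])
qed

lemma cuspidal_curvature_F:
  assumes "p$1 = 0" "j \<le> i" "j < n"
  shows "\<bar>cuspidal_curvature n j plane F p\<bar> = (if j < i then 0 else omega_value)"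
  unfolding cuspidal_curvature_def
proof (rule someI2_ex[where Q = "\<lambda>w. \<bar>w\<bar> = (if j < i then 0 else omega_value)"])
  show "\<exists>w c \<xi> \<eta>. adapted_pair n plane F p c \<xi> \<eta> \<and> w = omega_expr n j (local_rep c F) \<xi> \<eta> (snd c p)"
    using adapted_pair_coordinates(1)[OF assms(1)] by blast
next
  fix w assume "\<exists>c \<xi> \<eta>. adapted_pair n plane F p c \<xi> \<eta> \<and> w = omega_expr n j (local_rep c F) \<xi> \<eta> (snd c p)"
  then show "\<bar>w\<bar> = (if j < i then 0 else omega_value)"
    using adapted_pair_omega[OF assms(1), of _ _ _ j] assms by (metis less_imp_le)
qed

lemma bias_F:
  assumes "p$1 = 0" "i = n"
  shows "\<bar>bias n plane F p\<bar> = omega_value"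
  unfolding bias_def
proof (rule someI2_ex[where Q = "\<lambda>w. \<bar>w\<bar> = omega_value"])
  show "\<exists>w c \<xi> \<eta>. adapted_pair n plane F p c \<xi> \<eta> \<and>
      dir_deriv \<xi> (local_rep c F) (snd c p) \<bullet> (dir_deriv \<eta> ^^ n) (local_rep c F) (snd c p) = 0 \<and>
      w = omega_expr n n (local_rep c F) \<xi> \<eta> (snd c p)"
    using adapted_pair_coordinates[OF assms(1)]
    by (intro exI[of _ "(UNIV, id)"] exI[of _ "\<lambda>_. e_v"] exI[of _ "\<lambda>_. e_u"] exI) simp
next
  fix w assume "\<exists>c \<xi> \<eta>. adapted_pair n plane F p c \<xi> \<eta> \<and>
      dir_deriv \<xi> (local_rep c F) (snd c p) \<bullet> (dir_deriv \<eta> ^^ n) (local_rep c F) (snd c p) = 0 \<and>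
      w = omega_expr n n (local_rep c F) \<xi> \<eta> (snd c p)"
  then show "\<bar>w\<bar> = omega_value"
    using adapted_pair_omega[OF assms(1), of _ _ _ n] assms(2) by (metis less_irrefl order_refl)
qed

lemma omega_domain_F:
  assumes "p$1 = 0" "i \<le> n"
  shows "omega_domain n i plane F p"
proof -
  have "cuspidal_curvature n j plane F q = 0" if "j \<in> {1..<i}" "q$1 = 0" for j q
    using cuspidal_curvature_F[OF that(2), of j] that(1) assms(2) by simp
  then show ?thesis
    unfolding omega_domain_def singular_set_F using generic_helicoidal_edge_F assms(1) by simp
qed

end

section \<open>Isometric surfaces of revolution with different invariants\<close>

text \<open>Prescribing the slope means solving \<open>(n+i) a + u a' = n e^(u^n) h\<close>, and the smooth solution is the
  moment of order \<open>n + i - 1\<close> of the right hand side.\<close>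

lemma revolution_edge_with_slope:
  assumes "2 \<le> n" "1 \<le> i" "0 < m" "0 < \<rho>" "smooth_on UNIV h"
  obtains a where "revolution_edge n i m \<rho> a"
    "\<And>u. revolution_edge.slope n i \<rho> a u = \<rho> + u ^ i * h u" "a 0 = real n * h 0 / real (n + i)"
proof -
  define g where "g = (\<lambda>u. real n * exp (u ^ n) * h u)"
  define a where "a = moment (n + i - 1) g"
  have g: "smooth_on UNIV g" unfolding g_def by (intro smooth_on_intros assms open_UNIV)
  have a: "smooth_on UNIV a" unfolding a_def by (rule smooth_on_moment[OF g])
  interpret revolution_edge n i m \<rho> a by unfold_locales (use assms a in auto)
  have "Suc (n + i - 1) = n + i" using assms by simp
  then have ode: "real (n + i) * a u + u * frechet_derivative a (at u) 1 = g u" for u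
    using moment_ode[OF g a_deriv[of u, unfolded a_def]] by (simp add: a_def)
  have "exp (u ^ n) * exp (- (u ^ n)) = 1" for u :: real by (simp flip: exp_add)
  then have "g u * exp (- (u ^ n)) / real n = h u" for u
    using n by (simp add: g_def mult_ac)
  then have "slope u = \<rho> + u ^ i * h u" for u
    unfolding slope_def ode by simp
  moreover have "a 0 = real n * h 0 / real (n + i)"
    using ode[of 0] n by (simp add: g_def power_0_left field_simps)
  ultimately show thesis using that revolution_edge_axioms by blast
qed

lemma isometric_at_same_metric:
  assumes "\<And>x X Y. first_fundamental_form (UNIV, id) f x X Y = first_fundamental_form (UNIV, id) f\<^sub>2 x X Y"
  shows "isometric_at plane f\<^sub>2 f p"
proof -
  have "frechet_derivative (id :: real^2 \<Rightarrow> real^2) (at x) = id" for x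
    by (rule frechet_derivative_at[symmetric]) (rule has_derivative_id)
  moreover have "diffeo_of plane UNIV id"
    using diffeo_of_plane_translation[of 0] by (simp add: id_def)
  ultimately show ?thesis
    unfolding isometric_at_def using assms
    by (intro exI[of _ UNIV] exI[of _ id]) simp
qed

text \<open>The slopes \<open>1 + u^i\<close> for \<open>m = 1\<close> and \<open>s\<close> for \<open>m = 1/2\<close> satisfy \<open>1 + (1 + u^i)\<^sup>2 = 1/4 + s\<^sup>2\<close>. The difference
  \<open>s - \<rho>'\<close> is divided by \<open>u^i\<close> by rationalizing it, which gives \<open>h\<close> with \<open>h(0) = 1 / \<rho>'\<close>.\<close>

lemma isometric_edges:
  assumes "2 \<le> n" "1 \<le> i"
  obtains m \<rho> a m' \<rho>' a' where "revolution_edge n i m \<rho> a" "revolution_edge n i m' \<rho>' a'"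
    "isometric_at plane (edge n i m' \<rho>' a') (edge n i m \<rho> a) 0"
    "revolution_edge.omega_value n i m \<rho> a \<noteq> revolution_edge.omega_value n i m' \<rho>' a'"
proof -
  define s :: "real \<Rightarrow> real" where "s = (\<lambda>u. sqrt ((1 + u ^ i)\<^sup>2 + 3 / 4))"
  define \<rho>' :: real where "\<rho>' = sqrt (7 / 4)"
  define h where "h = (\<lambda>u. (2 + u ^ i) / (s u + \<rho>'))"
  have i0: "(0::real) ^ i = 0" using assms by simp
  have s0: "s 0 = \<rho>'" by (simp add: s_def \<rho>'_def i0)
  have spos: "s u > 0" for u by (simp add: s_def add_nonneg_pos)
  have \<rho>': "\<rho>' > 1" by (simp add: \<rho>'_def)
  have sum_pos: "s u + \<rho>' > 0" for u using spos[of u] \<rho>' by simp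
  have s2: "(s u)\<^sup>2 = (1 + u ^ i)\<^sup>2 + 3 / 4" for u by (simp add: s_def)
  have \<rho>2: "\<rho>'\<^sup>2 = 7 / 4" by (simp add: \<rho>'_def)
  have "smooth_on UNIV s"
    unfolding s_def by (intro smooth_on_sqrt smooth_on_intros open_UNIV) (simp add: add_nonneg_pos)
  then have h: "smooth_on UNIV h"
    unfolding h_def by (intro smooth_on_intros open_UNIV) (assumption, rule less_imp_neq[OF sum_pos, symmetric])
  have slope': "\<rho>' + u ^ i * h u = s u" for u
  proof -
    have "(s u - \<rho>') * (s u + \<rho>') = u ^ i * (2 + u ^ i)"
      using s2[of u] \<rho>2 by (simp add: power2_eq_square algebra_simps)
    then show ?thesis using sum_pos[of u] by (simp add: h_def field_simps)
  qed
  obtain a where A: "revolution_edge n i 1 1 a"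
    "\<And>u. revolution_edge.slope n i 1 a u = 1 + u ^ i * 1" "a 0 = real n * 1 / real (n + i)"
    using revolution_edge_with_slope[of n i 1 1 "\<lambda>_. 1"] assms by auto
  obtain a' where B: "revolution_edge n i (1/2) \<rho>' a'"
    "\<And>u. revolution_edge.slope n i \<rho>' a' u = \<rho>' + u ^ i * h u" "a' 0 = real n * h 0 / real (n + i)"
    using revolution_edge_with_slope[of n i "1/2" \<rho>' h] assms h \<rho>' by auto
  interpret A: revolution_edge n i 1 1 a by (rule A(1))
  interpret B: revolution_edge n i "1/2" \<rho>' a' by (rule B(1))
  have metric: "(A.slope u)\<^sup>2 + 1\<^sup>2 = (B.slope u)\<^sup>2 + (1 / 2)\<^sup>2" for u
    unfolding A(2) B(2) slope' s2 by (simp add: power2_eq_square)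
  have "isometric_at plane B.F A.F 0"
    by (rule isometric_at_same_metric)
       (simp only: A.first_fundamental_form_F B.first_fundamental_form_F metric A.speed_def B.speed_def)
  moreover have "A.omega_value \<noteq> B.omega_value"
  proof -
    define C :: real where "C = fact n * fact (n + i) / (fact n * sqrt 2) powr (real (2 * n + i) / real n)"
    have "C > 0" by (simp add: C_def)
    have "A.omega_value = \<bar>a 0\<bar> * C" by (simp add: A.omega_value_def C_def)
    moreover have "B.omega_value = 1 / 2 * \<bar>a' 0\<bar> * C"
    proof -
      have "(1 / 2)\<^sup>2 + \<rho>'\<^sup>2 = 2" unfolding \<rho>2 by (simp add: power2_eq_square)
      then show ?thesis by (simp add: B.omega_value_def C_def)
    qed
    moreover have "a' 0 = a 0 / \<rho>'"
      using \<rho>' by (simp add: A(3) B(3) h_def s0 i0)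
    moreover have "a 0 > 0" using A(3) assms by simp
    ultimately have A_val: "A.omega_value = a 0 * C" "a 0 * C > 0"
      and B_val: "B.omega_value = a 0 * C / (2 * \<rho>')"
      using \<open>C > 0\<close> \<rho>' by simp_all
    have "a 0 * C / (2 * \<rho>') < a 0 * C / 1"
      using A_val(2) \<rho>' by (intro divide_strict_left_mono) auto
    then show ?thesis unfolding A_val(1) B_val by simp
  qed
  ultimately show thesis using that A(1) B(1) by blast
qed

theorem corollary4p12:
  fixes n :: nat
  assumes "n \<ge> 2"
  shows "(\<forall>i\<in>{1..n-1}.
            extrinsic_on (omega_domain n i :: point manifold \<Rightarrow> (point \<Rightarrow> real^3) \<Rightarrow> point \<Rightarrow> bool)
              (cuspidal_curvature n i)) \<and>
         extrinsic_on (omega_domain n n :: point manifold \<Rightarrow> (point \<Rightarrow> real^3) \<Rightarrow> point \<Rightarrow> bool)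
           (bias n)"
proof (intro conjI ballI)
  have extrinsic: "extrinsic_on (omega_domain n i) J"
    if i: "1 \<le> i" "i \<le> n"
      and J: "\<And>m \<rho> a. revolution_edge n i m \<rho> a \<Longrightarrow>
        \<bar>J plane (edge n i m \<rho> a) 0\<bar> = revolution_edge.omega_value n i m \<rho> a"
    for i and J :: "point manifold \<Rightarrow> (point \<Rightarrow> real^3) \<Rightarrow> point \<Rightarrow> real"
  proof -
    obtain m \<rho> a m' \<rho>' a' where A: "revolution_edge n i m \<rho> a" and B: "revolution_edge n i m' \<rho>' a'"
      and iso: "isometric_at plane (edge n i m' \<rho>' a') (edge n i m \<rho> a) 0"
      and ne: "revolution_edge.omega_value n i m \<rho> a \<noteq> revolution_edge.omega_value n i m' \<rho>' a'"
      using isometric_edges[OF assms i(1)] by blast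
    have "omega_domain n i plane (edge n i m \<rho> a) 0" "omega_domain n i plane (edge n i m' \<rho>' a') 0"
      using A B i(2) by (auto intro: revolution_edge.omega_domain_F)
    with iso J[OF A] J[OF B] ne show ?thesis
      unfolding extrinsic_on_def intrinsic_on_def by metis
  qed
  show "extrinsic_on (omega_domain n i :: point manifold \<Rightarrow> (point \<Rightarrow> real^3) \<Rightarrow> point \<Rightarrow> bool)
      (cuspidal_curvature n i)" if "i \<in> {1..n-1}" for i
    by (rule extrinsic) (use that revolution_edge.cuspidal_curvature_F[of n i _ _ _ 0 i] in auto)
  show "extrinsic_on (omega_domain n n :: point manifold \<Rightarrow> (point \<Rightarrow> real^3) \<Rightarrow> point \<Rightarrow> bool) (bias n)"
    by (rule extrinsic) (use assms revolution_edge.bias_F[of n n _ _ _ 0] in auto)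
qed

end
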